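(* Let $k\geq 1$ and let $(j_1,\ldots,j_r)$ be a partition of $k$, i.e. integers $j_1\geq\cdots\geq j_r\geq 1$ with $j_1+\cdots+j_r=k$. Let $a_{j_1,\ldots,j_r}$ be the coefficient of $p_{j_1}\cdots p_{j_r}$ in the $k$th $\hat{A}$-polynomial $\hat{A}_k(p_1,\ldots,p_k)$. Then $$a_{j_1,\ldots,j_r} = \frac{(-1)^r}{\alpha_1! \cdots \alpha_k!}\, \frac{1}{(2\pi)^{2k}}\, S^\Sigma(2j_1,\ldots,2 j_r),$$ where, for $1\le\ell\le k$, $\alpha_\ell$ is the number of $j_1,\ldots,j_r$ that are equal to $\ell$. In particular, the coefficient $a_{j_1,\ldots,j_r}$ is negative if $r$ is odd and positive if $r$ is even.
   Context: The $\hat{A}$-polynomials $\hat{A}_k=\hat{A}_k(p_1,\ldots,p_k)$ are the polynomials with rational coefficients in indeterminates $p_1,p_2,\ldots$ forming the multiplicative sequence with characteristic power series $Q(z)=\frac{\sqrt z/2}{\sinh(\sqrt z/2)}\in\mathbb{Q}[[z]]$. Explicitly, for any $m\geq k$, if $p_i$ is replaced by the $i$th elementary symmetric polynomial in $x_1,\ldots,x_m$, then $\hat{A}_k(p_1,\ldots,p_k)$ is the homogeneous degree $k$ part of $Q(x_1)\cdots Q(x_m)$; this determines $\hat{A}_k$ uniquely. For example $\hat{A}_1=-\frac1{24}p_1$, $\hat{A}_2=\frac1{5760}(-4p_2+7p_1^2)$, $\hat{A}_3=\frac1{967680}(-16p_3+44p_2p_1-31p_1^3)$. One writes $\hat{A}_k=\sum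 a_{j_1,\ldots,j_r}p_{j_1}\cdots p_{j_r}$, the sum being over all partitions $(j_1,\ldots,j_r)$ of $k$. For real numbers $s_1,\ldots,s_r>1$, define $$S(s_1,\ldots,s_r) = \sum_{n_1\geq \cdots \geq n_r \geq 1} \frac{1}{n_1^{s_1} \cdots n_r^{s_r}},\qquad S^\Sigma(s_1,\ldots, s_r) = \sum_{\sigma\in\Sigma_r} S(s_{\sigma_1},\ldots,s_{\sigma_r}),$$ where the $n_i$ are integers and $\Sigma_r$ is the symmetric group on $\{1,\ldots,r\}$. *)

theory Defs
  imports
    "HOL-Analysis.Analysis"
    "HOL-Computational_Algebra.Computational_Algebra"
    "HOL-Combinatorics.Permutations"
    "HOL-Library.Poly_Mapping"
begin

section \<open>Multivariate polynomials with rational coefficients\<close>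

text \<open>
  A monomial is a finitely supported exponent function, and a polynomial is a finitely supported
  map from monomials to coefficients; multiplication on \<^type>\<open>poly_mapping\<close> is
  convolution. The indeterminates are indexed by all natural numbers, but only
  positive indices are used below. The same type serves for polynomials in
  \<open>p\<^sub>1, p\<^sub>2, \<dots>\<close> and in \<open>x\<^sub>1, x\<^sub>2, \<dots>\<close>.
\<close>

type_synonym qpoly = "(nat \<Rightarrow>\<^sub>0 nat) \<Rightarrow>\<^sub>0 rat"

definition var :: "nat \<Rightarrow> qpoly" where
  "var i = Poly_Mapping.single (Poly_Mapping.single i 1) 1"

definition qconst :: "rat \<Rightarrow> qpoly" where
  "qconst c = Poly_Mapping.single 0 c"

definition indets :: "qpoly \<Rightarrow> nat set" where
  "indets P = (\<Union>\<mu>\<in>Poly_Mapping.keys P. Poly_Mapping.keys \<mu>)"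

definition poly_subst :: "(nat \<Rightarrow> qpoly) \<Rightarrow> qpoly \<Rightarrow> qpoly" where
  "poly_subst f P = (\<Sum>\<mu>\<in>Poly_Mapping.keys P.
     qconst (Poly_Mapping.lookup P \<mu>) * (\<Prod>i\<in>Poly_Mapping.keys \<mu>. f i ^ Poly_Mapping.lookup \<mu> i))"

definition elem_sym :: "nat \<Rightarrow> nat \<Rightarrow> qpoly" where
  "elem_sym m i = (\<Sum>J | J \<subseteq> {1..m} \<and> card J = i. \<Prod>j\<in>J. var j)"


section \<open>The characteristic power series\<close>

text \<open>
  With \<open>z = w\<^sup>2\<close>, the series \<open>Q(z) = (\<surd>z/2) / sinh (\<surd>z/2)\<close> becomes the
  series \<open>(w/2) / sinh (w/2)\<close> in \<open>w\<close>, which is even; the \<open>n\<close>-th coefficient of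
  \<open>Q\<close> is its coefficient at \<open>w\<^sup>2\<^sup>n\<close>.
\<close>

definition sinh_half :: "rat fps" where
  "sinh_half = fps_const (1/2) * (fps_exp (1/2) - fps_exp (- (1/2)))"

definition A_hat_series :: "rat fps" where
  "A_hat_series = Abs_fps (\<lambda>n. fps_nth ((fps_const (1/2) * fps_X) / sinh_half) (2 * n))"

lemma A_hat_series_compose_square:
  "A_hat_series oo fps_X ^ 2 = (fps_const (1/2) * fps_X) / sinh_half"
proof -
  define h :: "rat fps" where "h = Abs_fps (\<lambda>n. 1 / (4 ^ n * fact (2 * n + 1)))"
  have h0: "fps_nth h 0 \<noteq> 0"
    by (simp add: h_def)
  have "sinh_half = (fps_const (1/2) * fps_X) * (h oo fps_X ^ 2)"
  proof (rule fps_ext)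
    fix n :: nat
    show "fps_nth sinh_half n = fps_nth ((fps_const (1/2) * fps_X) * (h oo fps_X ^ 2)) n"
    proof (cases n)
      case 0
      then show ?thesis by (simp add: sinh_half_def)
    next
      case (Suc l)
      show ?thesis
      proof (cases "even l")
        case True
        then obtain q where "l = 2 * q" by (elim evenE)
        then show ?thesis using Suc
          by (simp add: sinh_half_def h_def fps_nth_compose_X_power mult.assoc
              power_divide power_mult del: fact_Suc)
      next
        case False
        then show ?thesis using Suc
          by (simp add: sinh_half_def fps_nth_compose_X_power mult.assoc)
      qed
    qed
  qed
  moreover have "fps_const (1/2) * fps_X \<noteq> (0 :: rat fps)"
    by simp
  ultimately have "(fps_const (1/2) * fps_X) / sinh_half = 1 / (h oo fps_X ^ 2)"
    by (metis div_mult_mult1 mult.right_neutral)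
  also have "\<dots> = inverse (h oo fps_X ^ 2)"
    using h0 by (simp add: fps_divide_unit)
  also have "\<dots> = inverse h oo fps_X ^ 2"
    using h0 by (intro fps_inverse_compose [symmetric]) simp_all
  finally have eq: "(fps_const (1/2) * fps_X) / sinh_half = inverse h oo fps_X ^ 2" .
  have "A_hat_series = inverse h"
    by (rule fps_ext) (simp add: A_hat_series_def eq fps_nth_compose_X_power)
  then show ?thesis by (simp add: eq)
qed


section \<open>The A-hat polynomials\<close>

text \<open>
  The homogeneous part of degree \<open>k\<close> of \<open>Q(x\<^sub>1) \<cdots> Q(x\<^sub>m)\<close> is the coefficient of
  \<open>t\<^sup>k\<close> in \<open>Q(x\<^sub>1 t) \<cdots> Q(x\<^sub>m t)\<close>, a power series in \<open>t\<close> over the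
  polynomial ring.
\<close>

definition Q_prod_part :: "nat \<Rightarrow> nat \<Rightarrow> qpoly" where
  "Q_prod_part m k =
     fps_nth (\<Prod>i=1..m. Abs_fps (\<lambda>n. qconst (fps_nth A_hat_series n) * var i ^ n)) k"

definition A_hat :: "nat \<Rightarrow> qpoly" where
  "A_hat k = (THE P. indets P \<subseteq> {1..k} \<and>
                 (\<forall>m\<ge>k. poly_subst (elem_sym m) P = Q_prod_part m k))"

text \<open>The coefficient of \<open>p\<^bsub>j\<^sub>1\<^esub> \<cdots> p\<^bsub>j\<^sub>r\<^esub>\<close> in \<open>P\<close>:\<close>

definition coeff_at :: "qpoly \<Rightarrow> nat list \<Rightarrow> rat" where
  "coeff_at P js = Poly_Mapping.lookup P (\<Sum>j\<leftarrow>js. Poly_Mapping.single j 1)"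

definition is_partition :: "nat list \<Rightarrow> nat \<Rightarrow> bool" where
  "is_partition js k \<longleftrightarrow> sorted_wrt (\<ge>) js \<and> (\<forall>j\<in>set js. j \<ge> 1) \<and> sum_list js = k"


section \<open>Multiple zeta sums\<close>

text \<open>
  The sums are meant for arguments that are all greater than 1, where they converge absolutely.
\<close>

definition mzs :: "real list \<Rightarrow> real" where
  "mzs s = (\<Sum>\<^sub>\<infinity>ns\<in>{ns :: nat list. length ns = length s \<and> sorted_wrt (\<ge>) ns \<and> (\<forall>n\<in>set ns. n \<ge> 1)}.
            1 / (\<Prod>i<length s. real (ns ! i) powr (s ! i)))"

definition mzs_sym :: "real list \<Rightarrow> real" where
  "mzs_sym s = (\<Sum>\<sigma> | \<sigma> permutes {..<length s}. mzs (permute_list \<sigma> s))"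

end

theory Submission
  imports
    Defs
    "HOL-Complex_Analysis.Cauchy_Integral_Formula"
    "HOL-Combinatorics.Multiset_Permutations"
begin

text \<open>
  Euler's product gives \<open>Q(z) = \<Prod>n\<ge>1. 1 / (1 + z y\<^sub>n)\<close> with \<open>y\<^sub>n = 1 / (4 \<pi>\<^sup>2 n\<^sup>2)\<close>. Hence
  \<open>Q(x\<^sub>1) \<cdots> Q(x\<^sub>m)\<close> is the product over \<open>n\<close> of \<open>1 / E(y\<^sub>n)\<close>, where
  \<open>E(t) = (1 + x\<^sub>1 t) \<cdots> (1 + x\<^sub>m t) = 1 + e\<^sub>1 t + e\<^sub>2 t\<^sup>2 + \<cdots>\<close> is the generating function of the elementary
  symmetric polynomials. The geometric series expands \<open>1 / E(y\<^sub>n)\<close> into the sum of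
  \<open>(-1)\<^sup>r e\<^bsub>j\<^sub>1\<^esub> \<cdots> e\<^bsub>j\<^sub>r\<^esub> y\<^sub>n\<close> to the power \<open>j\<^sub>1 + \<cdots> + j\<^sub>r\<close>, over all finite
  sequences of positive integers. To multiply these sums over all \<open>n\<close>, concatenate the sequences chosen for
  the various \<open>n\<close>, the largest \<open>n\<close> first: the result is a sequence \<open>(j\<^sub>1, \<dots>, j\<^sub>r)\<close>
  together with a weakly decreasing sequence \<open>n\<^sub>1 \<ge> \<cdots> \<ge> n\<^sub>r\<close>, and every such pair arises once.
  Summing over the \<open>n\<^sub>i\<close> first, the part of degree \<open>k\<close> becomes the sum over all compositions
  \<open>(j\<^sub>1, \<dots>, j\<^sub>r)\<close> of \<open>k\<close> of
  \<open>(-1)\<^sup>r S(2 j\<^sub>1, \<dots>, 2 j\<^sub>r) e\<^bsub>j\<^sub>1\<^esub> \<cdots> e\<^bsub>j\<^sub>r\<^esub> / (2 \<pi>)\<^bsup>2k\<^esup>\<close>.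
  The coefficient at a partition collects its distinct rearrangements, and the sum over all permutations in
  \<open>S\<^sup>\<Sigma>\<close> counts each of them \<open>\<alpha>\<^sub>1! \<cdots> \<alpha>\<^sub>k!\<close> times (\<open>sum_permute_list\<close>). The sign is that of
  \<open>(-1)\<^sup>r\<close>, because the sums \<open>S\<close> are positive.

  Two points need care. First, the infinite product over \<open>n\<close> is replaced by \<open>n \<le> N\<close>, with \<open>1 / n\<^sup>2\<close> in place
  of \<open>y\<^sub>n\<close>, so that the expansion is an identity between polynomials with rational coefficients
  (\<open>prod_trunc_Q\<close>); then \<open>N\<close> tends to infinity in each coefficient separately
  (\<open>trunc_Q_tendsto\<close>, \<open>trunc_mzs_tendsto\<close>), where homogeneity accounts for the factor
  \<open>(4 \<pi>\<^sup>2)\<^sup>k\<close>. Second, this gives an expansion in products of elementary symmetric polynomials whose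
  coefficients are a priori only real, whereas \<open>A_hat k\<close> is defined as the only polynomial with
  rational coefficients that has the required property. Both the rationality of the real coefficients and the
  uniqueness follow from one fact: distinct products \<open>e\<^bsub>j\<^sub>1\<^esub> \<cdots> e\<^bsub>j\<^sub>r\<^esub>\<close> have
  distinct lowest monomials for a suitable weight, so the coefficients can be read off by solving a unitriangular
  system over the rationals (\<open>elem_monomial_coefficients_in_subspace\<close>).
\<close>

(* This leaves the dollar sign to the coefficients of power series. *)
unbundle no vec_syntax


section \<open>Constants and coefficients\<close>

lemma qconst_0 [simp]: "qconst 0 = 0"
  and qconst_1 [simp]: "qconst 1 = 1"
  and qconst_add: "qconst (a + b) = qconst a + qconst b"
  and qconst_mult: "qconst (a * b) = qconst a * qconst b"
  by (simp_all add: qconst_def single_add mult_single)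

lemma qconst_power: "qconst (a ^ n) = qconst a ^ n"
  by (induction n) (simp_all add: qconst_mult)

lemma qconst_sum: "qconst (sum f A) = (\<Sum>a\<in>A. qconst (f a))"
  by (induction A rule: infinite_finite_induct) (simp_all add: qconst_add)

lemma qconst_uminus: "qconst (- a) = - qconst a"
  by (simp add: qconst_def single_uminus)

lemma lookup_mult_single:
  fixes P :: "'a::cancel_comm_monoid_add \<Rightarrow>\<^sub>0 'b::comm_semiring_0"
  shows "Poly_Mapping.lookup (P * Poly_Mapping.single s c) (t + s) = Poly_Mapping.lookup P t * c"
proof -
  have "(\<Sum>q. Poly_Mapping.lookup (Poly_Mapping.single s c) q when t + s = l + q) = (c when l = t)" for l
  proof -
    have "(\<lambda>q. Poly_Mapping.lookup (Poly_Mapping.single s c) q when t + s = l + q)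
        = (\<lambda>q. (c when l = t) when q = s)"
      by (auto simp: fun_eq_iff lookup_single when_def)
    then show ?thesis by (simp only: Sum_any_when_equal)
  qed
  then have "Poly_Mapping.lookup (P * Poly_Mapping.single s c) (t + s)
     = (\<Sum>l. Poly_Mapping.lookup P l * c when l = t)"
    by (simp add: lookup_mult mult_when)
  also have "\<dots> = Poly_Mapping.lookup P t * c"
    by simp
  finally show ?thesis .
qed

lemma lookup_qconst_mult: "Poly_Mapping.lookup (qconst c * P) \<nu> = c * Poly_Mapping.lookup P \<nu>"
  using lookup_mult_single[of P 0 c \<nu>] by (simp add: qconst_def mult.commute)

section \<open>The expansion of a finite product into compositions\<close>

text \<open>
  For \<open>u n = 1 / n\<^sup>2\<close> this is the part \<open>N \<ge> n\<^sub>1 \<ge> \<cdots> \<ge> n\<^sub>r \<ge> 1\<close> of the series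
  \<open>S(2 j\<^sub>1, \<dots>, 2 j\<^sub>r)\<close> (\<open>trunc_mzs_eq_sum\<close>). The recursion separates the terms with \<open>n\<^sub>1 \<le> N\<close> from those
  with \<open>n\<^sub>1 = N + 1\<close>, in which \<open>n\<^sub>2\<close> may again be as large as \<open>N + 1\<close>; this is the
  shape in which the sums enter the expansion of a finite product.
\<close>
fun trunc_mzs :: "(nat \<Rightarrow> 'a::comm_ring_1) \<Rightarrow> nat \<Rightarrow> nat list \<Rightarrow> 'a" where
  "trunc_mzs u N [] = 1"
| "trunc_mzs u 0 (j # js) = 0"
| "trunc_mzs u (Suc N) (j # js) = trunc_mzs u N (j # js) + u (Suc N) ^ j * trunc_mzs u (Suc N) js"

definition compositions :: "nat \<Rightarrow> nat list set" where
  "compositions k = {js. (\<forall>j\<in>set js. j \<ge> 1) \<and> sum_list js = k}"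

lemma compositions_0: "compositions 0 = {[]}"
proof -
  have "js = []" if "js \<in> compositions 0" for js
    using that by (cases js) (auto simp: compositions_def)
  then show ?thesis by (auto simp: compositions_def)
qed

lemma compositions_rec:
  assumes "k \<ge> 1"
  shows "compositions k = (\<Union>j\<in>{1..k}. (#) j ` compositions (k - j))"
proof (intro equalityI subsetI)
  fix js assume js: "js \<in> compositions k"
  then obtain j ls where [simp]: "js = j # ls"
    using assms by (cases js) (auto simp: compositions_def)
  from js show "js \<in> (\<Union>j\<in>{1..k}. (#) j ` compositions (k - j))"
    by (auto simp: compositions_def intro!: bexI[of _ j])
qed (auto simp: compositions_def)

lemma finite_compositions [simp]: "finite (compositions k)"
proof (induction k rule: less_induct)
  case (less k)
  show ?case
  proof (cases "k = 0")
    case False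
    then show ?thesis using less by (simp add: compositions_rec)
  qed (simp add: compositions_0)
qed

lemma sum_compositions_rec:
  assumes "k \<ge> 1"
  shows "sum f (compositions k) = (\<Sum>j=1..k. \<Sum>js\<in>compositions (k - j). f (j # js))"
  unfolding compositions_rec[OF assms]
  by (subst sum.UNION_disjoint) (auto simp: sum.reindex)

text \<open>
  The expansion of \<open>\<Prod>1\<le>n\<le>N. 1 / (1 + e\<^sub>1 u\<^sub>n t + e\<^sub>2 u\<^sub>n\<^sup>2 t\<^sup>2 + \<cdots>)\<close> as a power series in \<open>t\<close>,
  justified by \<open>comp_series_0\<close> and \<open>comp_series_Suc\<close>.
\<close>
definition comp_series :: "(nat \<Rightarrow> rat) \<Rightarrow> (nat \<Rightarrow> qpoly) \<Rightarrow> nat \<Rightarrow> qpoly fps" where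
  "comp_series u e N = Abs_fps (\<lambda>k. \<Sum>js\<in>compositions k.
     qconst ((-1) ^ length js * trunc_mzs u N js) * prod_list (map e js))"

lemma comp_series_0: "comp_series u e 0 = 1"
proof (rule fps_ext)
  fix k
  show "comp_series u e 0 $ k = 1 $ k"
  proof (cases "k = 0")
    case False
    then show ?thesis
      by (simp add: comp_series_def sum_compositions_rec)
  qed (simp add: comp_series_def compositions_0)
qed

text \<open>
  Splitting off the first part \<open>j\<close> of each nonempty composition, the recursion of \<open>trunc_mzs\<close> says that
  passing from \<open>N\<close> to \<open>N + 1\<close> changes the series \<open>G\<^sub>N\<close> by
  \<open>- (e\<^sub>1 u t + e\<^sub>2 u\<^sup>2 t\<^sup>2 + \<cdots>) G\<^bsub>N+1\<^esub>\<close>, where \<open>u = u\<^bsub>N+1\<^esub>\<close>. The minus sign comes from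
  \<open>(-1)\<^sup>r\<close>, as the composition has become longer by one part.
\<close>
lemma comp_series_Suc:
  assumes "e 0 = 1"
  shows "comp_series u e (Suc N) * Abs_fps (\<lambda>j. qconst (u (Suc N) ^ j) * e j) = comp_series u e N"
proof (rule fps_ext)
  fix k
  let ?G = "comp_series u e" and ?w = "\<lambda>j. qconst (u (Suc N) ^ j) * e j"
  have "?G (Suc N) $ k + (\<Sum>j=1..k. ?w j * ?G (Suc N) $ (k - j)) = ?G N $ k"
  proof (cases "k = 0")
    case False
    then have "?G (Suc N) $ k - ?G N $ k =
      (\<Sum>j=1..k. \<Sum>js\<in>compositions (k - j).
         - (?w j * (qconst ((-1) ^ length js * trunc_mzs u (Suc N) js) * prod_list (map e js))))"
      by (simp add: comp_series_def sum_compositions_rec sum_subtractf[symmetric]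
           qconst_mult qconst_add qconst_uminus algebra_simps)
    also have "\<dots> = - (\<Sum>j=1..k. ?w j * ?G (Suc N) $ (k - j))"
      by (simp add: comp_series_def sum_negf sum_distrib_left)
    finally show ?thesis by (simp add: algebra_simps)
  qed (simp add: comp_series_def compositions_0)
  moreover have "(?G (Suc N) * Abs_fps ?w) $ k = (\<Sum>j=0..k. ?w j * ?G (Suc N) $ (k - j))"
    by (subst mult.commute) (simp add: fps_mult_nth)
  moreover have "\<dots> = ?G (Suc N) $ k + (\<Sum>j=1..k. ?w j * ?G (Suc N) $ (k - j))"
    using assms by (subst sum.atLeast_Suc_atMost) simp_all
  ultimately show "(?G (Suc N) * Abs_fps ?w) $ k = ?G N $ k"
    by simp
qed

text \<open>
  The series \<open>f(x t)\<close> in \<open>t\<close>. As a function of \<open>f\<close> it is a ring homomorphism, which carries identities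
  between rational series over to the polynomial ring.
\<close>
definition series_at :: "rat fps \<Rightarrow> qpoly \<Rightarrow> qpoly fps" where
  "series_at f x = Abs_fps (\<lambda>n. qconst (f $ n) * x ^ n)"

lemma series_at_1: "series_at 1 x = 1"
  by (rule fps_ext) (simp add: series_at_def)

lemma series_at_linear: "series_at (1 + fps_const c * fps_X) x = 1 + fps_const (qconst c * x) * fps_X"
  by (rule fps_ext) (auto simp: series_at_def qconst_add fps_X_def)

lemma series_at_mult: "series_at (f * g) x = series_at f x * series_at g x"
proof (rule fps_ext)
  fix n
  have "qconst (\<Sum>i=0..n. f $ i * g $ (n - i)) * x ^ n
     = (\<Sum>i=0..n. (qconst (f $ i) * x ^ i) * (qconst (g $ (n - i)) * x ^ (n - i)))"
    unfolding qconst_sum sum_distrib_right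
  proof (intro sum.cong refl)
    fix i assume "i \<in> {0..n}"
    then have "x ^ n = x ^ i * x ^ (n - i)" by (simp flip: power_add)
    then show "qconst (f $ i * g $ (n - i)) * x ^ n
      = qconst (f $ i) * x ^ i * (qconst (g $ (n - i)) * x ^ (n - i))"
      by (simp add: qconst_mult mult_ac)
  qed
  then show "series_at (f * g) x $ n = (series_at f x * series_at g x) $ n"
    by (simp add: series_at_def fps_mult_nth)
qed

lemma elem_sym_0: "elem_sym m 0 = 1"
proof -
  have "{J. J \<subseteq> {1..m} \<and> card J = 0} = {{}}"
    by (auto dest: finite_subset[OF _ finite_atLeastAtMost])
  then show ?thesis by (simp add: elem_sym_def)
qed

lemma elem_sym_generating_function:
  "Abs_fps (\<lambda>j. qconst (c ^ j) * elem_sym m j) = (\<Prod>i=1..m. 1 + fps_const (qconst c * var i) * fps_X)"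
proof (rule fps_ext)
  fix n
  have "(\<Prod>i=1..m. 1 + fps_const (qconst c * var i) * fps_X)
     = (\<Prod>i=1..m. fps_const (qconst c * var i) * fps_X + 1)"
    by (simp add: add.commute)
  also have "\<dots> = (\<Sum>J\<in>Pow {1..m}. (\<Prod>i\<in>J. fps_const (qconst c * var i) * fps_X))"
    by (subst prod_add) simp_all
  also have "\<dots> = (\<Sum>J\<in>Pow {1..m}. fps_const (qconst (c ^ card J) * (\<Prod>i\<in>J. var i)) * fps_X ^ card J)"
  proof (intro sum.cong refl)
    fix J
    have "(\<Prod>i\<in>J. fps_const (x i)) = fps_const (\<Prod>i\<in>J. x i)" for x :: "nat \<Rightarrow> qpoly"
      by (induction J rule: infinite_finite_induct) simp_all
    then show "(\<Prod>i\<in>J. fps_const (qconst c * var i) * fps_X)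
      = fps_const (qconst (c ^ card J) * (\<Prod>i\<in>J. var i)) * fps_X ^ card J"
      by (simp add: prod.distrib qconst_power)
  qed
  also have "\<dots> $ n = (\<Sum>J\<in>Pow {1..m}. if card J = n then qconst (c ^ n) * (\<Prod>i\<in>J. var i) else 0)"
    by (auto simp: fps_sum_nth intro!: sum.cong)
  also have "\<dots> = qconst (c ^ n) * elem_sym m n"
    by (auto simp: elem_sym_def sum_distrib_left Pow_def sum.inter_filter[symmetric] intro!: sum.cong)
  finally show "Abs_fps (\<lambda>j. qconst (c ^ j) * elem_sym m j) $ n = (\<Prod>i=1..m. 1 + fps_const (qconst c * var i) * fps_X) $ n"
    by simp
qed

definition trunc_Q :: "(nat \<Rightarrow> rat) \<Rightarrow> nat \<Rightarrow> rat fps" where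
  "trunc_Q u N = (\<Prod>n=1..N. inverse (1 + fps_const (u n) * fps_X))"

lemma trunc_Q_Suc: "trunc_Q u (Suc N) * (1 + fps_const (u (Suc N)) * fps_X) = trunc_Q u N"
  by (simp add: trunc_Q_def mult.assoc inverse_mult_eq_1)

text \<open>
  Both sides, for \<open>N + 1\<close>, become the corresponding side for \<open>N\<close> after multiplication with
  \<open>E(u t) = \<Prod>i. (1 + u x\<^sub>i t)\<close>, \<open>u = u\<^bsub>N+1\<^esub>\<close>. Cancelling \<open>E(u t)\<close> is legitimate because it
  has an inverse, the product of the geometric series \<open>1 / (1 + u x\<^sub>i t)\<close>; no division in the polynomial ring is
  involved.
\<close>
lemma prod_trunc_Q:
  "(\<Prod>i=1..m. series_at (trunc_Q u N) (var i)) = comp_series u (elem_sym m) N"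
proof (induction N)
  case 0
  then show ?case by (simp add: comp_series_0 trunc_Q_def series_at_1)
next
  case (Suc N)
  let ?c = "u (Suc N)"
  define E where "E = Abs_fps (\<lambda>j. qconst (?c ^ j) * elem_sym m j)"
  define I where "I = (\<Prod>i=1..m. series_at (inverse (1 + fps_const ?c * fps_X)) (var i))"
  have E: "E = (\<Prod>i=1..m. series_at (1 + fps_const ?c * fps_X) (var i))"
    by (simp add: E_def elem_sym_generating_function series_at_linear)
  have EI: "E * I = 1"
    by (simp add: E I_def prod.distrib[symmetric] series_at_mult[symmetric] inverse_mult_eq_1' series_at_1)
  have "(\<Prod>i=1..m. series_at (trunc_Q u (Suc N)) (var i)) * E = (\<Prod>i=1..m. series_at (trunc_Q u N) (var i))"
    by (simp add: E prod.distrib[symmetric] series_at_mult[symmetric] trunc_Q_Suc)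
  also have "\<dots> = comp_series u (elem_sym m) (Suc N) * E"
    unfolding Suc E_def by (rule comp_series_Suc[symmetric]) (rule elem_sym_0)
  finally have "(\<Prod>i=1..m. series_at (trunc_Q u (Suc N)) (var i)) * E * I
      = comp_series u (elem_sym m) (Suc N) * E * I"
    by simp
  then show ?case by (simp add: mult.assoc EI)
qed

section \<open>Coefficients of a product of one-variable series\<close>

definition deg_mono :: "(nat \<Rightarrow>\<^sub>0 nat) \<Rightarrow> nat" where
  "deg_mono \<nu> = (\<Sum>i\<in>Poly_Mapping.keys \<nu>. Poly_Mapping.lookup \<nu> i)"

lemma deg_mono_superset:
  assumes "finite A" "Poly_Mapping.keys \<nu> \<subseteq> A"
  shows "deg_mono \<nu> = (\<Sum>i\<in>A. Poly_Mapping.lookup \<nu> i)"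
  unfolding deg_mono_def using assms
  by (intro sum.mono_neutral_left) (auto simp: in_keys_iff)

lemma var_power: "var i ^ n = Poly_Mapping.single (Poly_Mapping.single i n) 1"
  by (induction n) (simp_all add: var_def mult_single flip: single_add)

text \<open>
  The coefficient of a monomial is a finite product of coefficients of \<open>f\<close>, so it depends continuously on
  them. This is what makes the passage to the limit in \<open>f\<close> possible.
\<close>
lemma lookup_prod_series_at:
  "Poly_Mapping.lookup ((\<Prod>i=1..m. series_at f (var i)) $ k) \<nu> =
     (if Poly_Mapping.keys \<nu> \<subseteq> {1..m} \<and> deg_mono \<nu> = k
      then (\<Prod>i=1..m. f $ Poly_Mapping.lookup \<nu> i) else 0)"
proof (induction m arbitrary: k \<nu>)
  case 0
  have "1 $ k = (if k = 0 then 1 else 0 :: qpoly)" by simp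
  then show ?case by (auto simp: deg_mono_def lookup_one when_def)
next
  case (Suc m)
  let ?P = "\<lambda>i. (\<Prod>i=1..m. series_at f (var i)) $ i"
  let ?s = "\<lambda>n. Poly_Mapping.single (Suc m) n"
  define n where "n = Poly_Mapping.lookup \<nu> (Suc m)"
  define \<tau> where "\<tau> = \<nu> - ?s n"
  have \<tau>: "\<nu> = \<tau> + ?s n"
    by (rule poly_mapping_eqI) (auto simp: \<tau>_def n_def lookup_add lookup_minus lookup_single when_def)
  have l\<tau>: "Poly_Mapping.lookup \<tau> i = (if i = Suc m then 0 else Poly_Mapping.lookup \<nu> i)" for i
    by (auto simp: \<tau>_def n_def lookup_minus lookup_single when_def)
  \<comment> \<open>The first \<open>m\<close> factors do not involve the last variable, so its exponent in \<open>\<nu>\<close> selects one term of the convolution.\<close>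
  have zero: "Poly_Mapping.lookup (?P i * Poly_Mapping.single (?s b) c) \<nu> = 0" if "b \<noteq> n" for i b c
  proof (rule ccontr)
    assume "\<not> ?thesis"
    then have "\<nu> \<in> Poly_Mapping.keys (?P i * Poly_Mapping.single (?s b) c)"
      by (simp add: in_keys_iff)
    then obtain a where a: "a \<in> Poly_Mapping.keys (?P i)" "\<nu> = a + ?s b"
      using keys_mult[of "?P i" "Poly_Mapping.single (?s b) c"] by (auto split: if_splits)
    then have "Poly_Mapping.lookup a (Suc m) = 0"
      using Suc[of i a] by (auto simp: in_keys_iff split: if_splits)
    then show False using a(2) that by (simp add: n_def lookup_add)
  qed
  have "(\<Prod>i=1..Suc m. series_at f (var i)) $ k
     = (\<Sum>i=0..k. ?P i * Poly_Mapping.single (?s (k - i)) (f $ (k - i)))"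
    by (simp add: fps_mult_nth series_at_def var_power qconst_def mult_single)
  then have "Poly_Mapping.lookup ((\<Prod>i=1..Suc m. series_at f (var i)) $ k) \<nu>
     = (\<Sum>i=0..k. Poly_Mapping.lookup (?P i * Poly_Mapping.single (?s (k - i)) (f $ (k - i))) \<nu>)"
    by (simp add: lookup_sum)
  also have "\<dots> = (\<Sum>i=0..k. if k - i = n then Poly_Mapping.lookup (?P i) \<tau> * f $ n else 0)"
  proof (intro sum.cong refl)
    fix i assume "i \<in> {0..k}"
    show "Poly_Mapping.lookup (?P i * Poly_Mapping.single (?s (k - i)) (f $ (k - i))) \<nu>
      = (if k - i = n then Poly_Mapping.lookup (?P i) \<tau> * f $ n else 0)"
    proof (cases "k - i = n")
      case True
      then show ?thesis by (simp only: True \<tau> lookup_mult_single if_True)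
    next
      case False
      then show ?thesis by (simp only: zero[OF False] False if_False)
    qed
  qed
  also have "\<dots> = (\<Sum>i\<in>{0..k}. if i = k - n then (if n \<le> k then Poly_Mapping.lookup (?P (k - n)) \<tau> * f $ n else 0) else 0)"
    by (intro sum.cong refl) auto
  also have "\<dots> = (if n \<le> k then Poly_Mapping.lookup (?P (k - n)) \<tau> * f $ n else 0)"
    by (simp add: sum.delta)
  also have "\<dots> = (if Poly_Mapping.keys \<nu> \<subseteq> {1..Suc m} \<and> deg_mono \<nu> = k
      then (\<Prod>i=1..Suc m. f $ Poly_Mapping.lookup \<nu> i) else 0)"
  proof -
    have "Poly_Mapping.keys \<tau> = Poly_Mapping.keys \<nu> - {Suc m}"
      by (auto simp: in_keys_iff l\<tau> split: if_splits)
    moreover have "{1..Suc m} = insert (Suc m) {1..m}"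
      by auto
    ultimately have k: "Poly_Mapping.keys \<tau> \<subseteq> {1..m} \<longleftrightarrow> Poly_Mapping.keys \<nu> \<subseteq> {1..Suc m}"
      by auto
    have d: "deg_mono \<nu> = deg_mono \<tau> + n" if "Poly_Mapping.keys \<nu> \<subseteq> {1..Suc m}"
    proof -
      have "deg_mono \<nu> = (\<Sum>i=1..Suc m. Poly_Mapping.lookup \<nu> i)"
        using that by (intro deg_mono_superset) auto
      moreover have "deg_mono \<tau> = (\<Sum>i=1..m. Poly_Mapping.lookup \<tau> i)"
        using that k by (intro deg_mono_superset) auto
      ultimately show ?thesis by (simp add: n_def l\<tau>)
    qed
    have p: "(\<Prod>i=1..m. f $ Poly_Mapping.lookup \<tau> i) = (\<Prod>i=1..m. f $ Poly_Mapping.lookup \<nu> i)"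
      by (intro prod.cong) (auto simp: l\<tau>)
    show ?thesis
      unfolding Suc[of "k - n" \<tau>] k p using d by (auto simp: n_def)
  qed
  finally show ?case .
qed

lemma Q_prod_part_eq: "Q_prod_part m k = (\<Prod>i=1..m. series_at A_hat_series (var i)) $ k"
  by (simp add: Q_prod_part_def series_at_def)

section \<open>Euler's product for the characteristic series\<close>

definition euler_poly :: "nat \<Rightarrow> real poly" where
  "euler_poly N = (\<Prod>n=1..N. [:1, 1 / real n ^ 2:])"

lemma euler_poly_Suc: "euler_poly (Suc N) = euler_poly N * [:1, 1 / real (Suc N) ^ 2:]"
  by (simp add: euler_poly_def)

lemma coeff_euler_poly_Suc:
  "coeff (euler_poly (Suc N)) k =
     coeff (euler_poly N) k + (if k = 0 then 0 else coeff (euler_poly N) (k - 1) / real (Suc N) ^ 2)"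
  by (cases k) (simp_all add: euler_poly_Suc mult.commute[of "euler_poly N"])

lemma coeff_euler_poly_0: "coeff (euler_poly N) 0 = 1"
  by (induction N) (simp_all add: coeff_euler_poly_Suc, simp add: euler_poly_def)

lemma coeff_euler_poly_nonneg: "coeff (euler_poly N) k \<ge> 0"
  by (induction N arbitrary: k) (simp_all add: coeff_euler_poly_Suc, simp add: euler_poly_def)

lemma poly_euler_poly: "poly (euler_poly N) x = (\<Prod>n=1..N. 1 + x / real n ^ 2)"
  by (simp add: euler_poly_def poly_prod)

lemma poly_euler_poly_1_le: "\<exists>C. \<forall>N. poly (euler_poly N) 1 \<le> C"
proof (intro exI allI)
  fix N
  have summ: "summable (\<lambda>n. 1 / real n ^ 2)"
    using inverse_power_summable[of 2, where 'a = real] by (simp add: field_simps)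
  have "poly (euler_poly N) 1 \<le> (\<Prod>n=1..N. exp (1 / real n ^ 2))"
    unfolding poly_euler_poly by (intro prod_mono) (auto simp: add_nonneg_nonneg)
  also have "\<dots> = exp (\<Sum>n=1..N. 1 / real n ^ 2)"
    by (simp add: exp_sum)
  also have "\<dots> \<le> exp (suminf (\<lambda>n. 1 / real n ^ 2))"
    using sum_le_suminf[OF summ, of "{1..N}"] by simp
  finally show "poly (euler_poly N) 1 \<le> exp (suminf (\<lambda>n. 1 / real n ^ 2))" .
qed

lemma coeff_le_poly_1:
  assumes "\<And>k. coeff p k \<ge> (0::real)"
  shows "coeff p k \<le> poly p 1"
proof (cases "k \<le> degree p")
  case True
  then show ?thesis
    using assms unfolding poly_altdef by (auto intro!: member_le_sum[where f = "coeff p"])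
next
  case False
  then show ?thesis
    using assms by (auto simp: poly_altdef coeff_eq_0 intro!: sum_nonneg)
qed

text \<open>
  The coefficients are the elementary symmetric functions of \<open>1, 1/4, \<dots>, 1/N\<^sup>2\<close>, which grow with \<open>N\<close> and are
  bounded by the value of the polynomial at 1.
\<close>
lemma convergent_coeff_euler_poly: "convergent (\<lambda>N. coeff (euler_poly N) k)"
proof -
  obtain C where C: "\<And>N. poly (euler_poly N) 1 \<le> C"
    using poly_euler_poly_1_le by blast
  have "incseq (\<lambda>N. coeff (euler_poly N) k)"
    by (intro incseq_SucI) (simp add: coeff_euler_poly_Suc coeff_euler_poly_nonneg)
  moreover have "coeff (euler_poly N) k \<le> C" for N
    using coeff_le_poly_1[of "euler_poly N" k] C[of N] coeff_euler_poly_nonneg by fastforce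
  ultimately show ?thesis
    by (meson Bseq_mono_convergent incseq_convergent convergent_def)
qed

lemma poly_as_suminf:
  fixes p :: "real poly"
  shows "poly p x = suminf (\<lambda>k. coeff p k * x ^ k)"
  unfolding poly_altdef by (rule suminf_finite[symmetric]) (auto simp: coeff_eq_0)

text \<open>
  Euler's sine product determines the values \<open>sin (\<pi> y) / (\<pi> y)\<close> of the limit function at \<open>-y\<^sup>2\<close>. The
  coefficients are bounded uniformly in \<open>N\<close>, so inside the unit disc the limit may be taken termwise, by Tannery's
  theorem. The limit is therefore a power series that agrees with the sine series at all small negative
  arguments, and nonzero power series have isolated zeros.
\<close>
lemma coeff_euler_poly_tendsto:
  "(\<lambda>N. coeff (euler_poly N) k) \<longlonglongrightarrow> pi ^ (2 * k) / fact (2 * k + 1)"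
proof -
  define E where "E = (\<lambda>k. lim (\<lambda>N. coeff (euler_poly N) k))"
  have E: "(\<lambda>N. coeff (euler_poly N) k) \<longlonglongrightarrow> E k" for k
    using convergent_coeff_euler_poly unfolding E_def by (simp add: convergent_LIMSEQ_iff)
  obtain C where C: "\<And>N. poly (euler_poly N) 1 \<le> C"
    using poly_euler_poly_1_le by blast
  have bound: "norm (coeff (euler_poly N) k * x ^ k) \<le> C * \<bar>x\<bar> ^ k" for N k and x :: real
    using order.trans[OF coeff_le_poly_1[OF coeff_euler_poly_nonneg] C, of N k] coeff_euler_poly_nonneg[of N k]
    by (auto simp: abs_mult power_abs intro!: mult_right_mono)
  have lim: "summable (\<lambda>k. E k * x ^ k) \<and> (\<lambda>N. poly (euler_poly N) x) \<longlonglongrightarrow> (suminf (\<lambda>k. E k * x ^ k))"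
    if "\<bar>x\<bar> < 1" for x :: real
  proof -
    have "eventually (\<lambda>N. summable (\<lambda>k. norm (coeff (euler_poly N) k * x ^ k))) sequentially \<and>
           summable (\<lambda>k. norm (E k * x ^ k)) \<and>
           (\<lambda>N. suminf (\<lambda>k. coeff (euler_poly N) k * x ^ k)) \<longlonglongrightarrow> (suminf (\<lambda>k. E k * x ^ k))"
    proof (rule tannerys_theorem)
      show "summable (\<lambda>k. C * \<bar>x\<bar> ^ k)"
        using that by (intro summable_mult summable_geometric) simp
      show "\<forall>\<^sub>F (k, N) in at_top \<times>\<^sub>F sequentially.
              norm (coeff (euler_poly N) k * x ^ k) \<le> C * \<bar>x\<bar> ^ k"
        by (intro always_eventually) (clarify, rule bound)
    qed (auto intro!: tendsto_intros E)
    then show ?thesis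
      by (simp add: poly_as_suminf summable_norm_cancel)
  qed
  define F where "F = (\<lambda>x. suminf (\<lambda>k. E k * x ^ k))"
  define S where "S = (\<lambda>k. pi ^ (2 * k) / fact (2 * k + 1))"
  have S: "(\<lambda>k. S k * (- (y^2)) ^ k) sums (sin (pi * y) / (pi * y))" if "y \<noteq> 0" for y
  proof -
    have "(\<lambda>k. (-1) ^ k / fact (2 * k + 1) * (pi * y) ^ (2 * k + 1) / (pi * y)) sums (sin (pi * y) / (pi * y))"
      by (intro sums_divide sin_paired)
    moreover have "(-1) ^ k / fact (2 * k + 1) * (pi * y) ^ (2 * k + 1) / (pi * y) = S k * (- (y^2)) ^ k" for k
    proof -
      have "(- (y^2)) ^ k = (-1) ^ k * y ^ (2 * k)"
        by (subst power_minus) (simp add: power_mult)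
      then show ?thesis
        using that by (simp add: S_def power_mult_distrib del: fact_Suc)
    qed
    ultimately show ?thesis by simp
  qed
  have F: "F (- (y^2)) = sin (pi * y) / (pi * y)" if "y \<noteq> 0" "\<bar>y\<bar> < 1" for y
  proof -
    have "\<bar>- (y^2)\<bar> < 1"
      using that by (simp add: abs_square_less_1)
    then have "(\<lambda>N. poly (euler_poly N) (- (y^2))) \<longlonglongrightarrow> F (- (y^2))"
      using lim unfolding F_def by blast
    moreover have "(\<lambda>N. poly (euler_poly N) (- (y^2))) \<longlonglongrightarrow> sin (pi * y) / (pi * y)"
      using sin_product_formula_real'[OF that(1)] by (simp add: poly_euler_poly)
    ultimately show ?thesis by (rule LIMSEQ_unique)
  qed
  have S_summable: "summable (\<lambda>k. S k * x ^ k)" for x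
  proof -
    \<comment> \<open>Any \<open>y\<close> with \<open>y\<^sup>2 > \<bar>x\<bar>\<close> will do: the sine series converges at every \<open>- y\<^sup>2\<close>.\<close>
    define y where "y = sqrt \<bar>x\<bar> + 1"
    have y: "y > 0" "\<bar>x\<bar> < y\<^sup>2"
      by (auto simp: y_def power2_sum intro: add_nonneg_pos add_pos_nonneg)
    show ?thesis
      using powser_inside[OF sums_summable[OF S[of y]], of x] y by simp
  qed
  define f where "f = (\<lambda>x. F x - (suminf (\<lambda>k. S k * x ^ k)))"
  have f: "(\<lambda>k. (E k - S k) * x ^ k) sums f x" if "norm (x - 0) < 1" for x
  proof -
    have "(\<lambda>k. E k * x ^ k - S k * x ^ k) sums f x"
      unfolding f_def F_def using lim[of x] that
      by (intro sums_diff summable_sums S_summable) auto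
    then show ?thesis by (simp add: algebra_simps)
  qed
  have f0: "f (- (y^2)) = 0" if "y \<noteq> 0" "\<bar>y\<bar> < 1" for y
    using F[OF that] S[OF that(1)] by (simp add: f_def sums_iff)
  have E0: "E 0 = S 0"
    using LIMSEQ_unique[OF E[of 0]] by (simp add: coeff_euler_poly_0 S_def)
  have "E k = S k"
  proof (cases "k = 0")
    case False
    show ?thesis
    proof (rule ccontr)
      assume "E k \<noteq> S k"
      have f00: "f 0 = 0"
        using sums_unique2[OF f[of 0] powser_sums_zero[of "\<lambda>k. E k - S k"]] E0 by simp
      obtain s where s: "s > 0" "\<And>z. z \<in> cball 0 s - {0} \<Longrightarrow> f z \<noteq> 0"
        using powser_0_nonzero[of 1 0 "\<lambda>k. E k - S k" f k] f f00 \<open>E k \<noteq> S k\<close> False by auto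
      \<comment> \<open>A small \<open>y\<close> with \<open>- y\<^sup>2\<close> inside the punctured disc, where \<open>f\<close> both vanishes and does not vanish.\<close>
      define y where "y = min (1/2) s"
      have y: "0 < y" "y \<le> 1/2" "y \<le> s"
        using s(1) by (auto simp: y_def)
      have "y ^ 2 \<le> s"
        using mult_mono[of y 1 y s] y by (simp add: power2_eq_square)
      then have "- (y^2) \<in> cball 0 s - {0}"
        using y by simp
      then show False
        using s(2) f0[of y] y by auto
    qed
  qed (simp add: E0)
  then show ?thesis using E[of k] by (simp add: S_def)
qed

definition basel :: "nat \<Rightarrow> rat" where
  "basel n = 1 / of_nat n ^ 2"

lemma coeff_euler_poly_eq:
  "of_rat ((\<Prod>n=1..N. 1 + fps_const (basel n) * fps_X) $ k) = coeff (euler_poly N) k"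
proof (induction N arbitrary: k)
  case 0
  then show ?case by (simp add: euler_poly_def)
next
  case (Suc N)
  let ?P = "\<Prod>n=1..N. 1 + fps_const (basel n) * fps_X"
  have "(\<Prod>n=1..Suc N. 1 + fps_const (basel n) * fps_X)
      = ?P + fps_const (basel (Suc N)) * (?P * fps_X)"
    by (simp add: algebra_simps)
  then show ?case
    unfolding coeff_euler_poly_Suc Suc[symmetric]
    by (simp add: of_rat_add of_rat_mult basel_def of_rat_divide of_rat_power del: of_nat_Suc)
qed

text \<open>
  Cancelling the common factor \<open>w / 2\<close> of numerator and denominator turns \<open>Q\<close> into the inverse of the series of
  \<open>sinh (w/2) / (w/2)\<close>, read as a series in \<open>z = w\<^sup>2\<close>.
\<close>
lemma A_hat_series_mult:
  "A_hat_series * Abs_fps (\<lambda>n. 1 / (4 ^ n * fact (2 * n + 1))) = 1"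
proof -
  define h :: "rat fps" where "h = Abs_fps (\<lambda>n. 1 / (4 ^ n * fact (2 * n + 1)))"
  have "sinh_half = (fps_const (1/2) * fps_X) * (h oo fps_X ^ 2)"
  proof (rule fps_ext)
    fix n :: nat
    show "sinh_half $ n = ((fps_const (1/2) * fps_X) * (h oo fps_X ^ 2)) $ n"
    proof (cases n)
      case (Suc l)
      then show ?thesis
        by (cases "even l") (auto elim!: evenE simp: sinh_half_def h_def fps_nth_compose_X_power
              mult.assoc power_divide power_mult simp del: fact_Suc)
    qed (simp add: sinh_half_def)
  qed
  moreover have "fps_const (1/2) * fps_X \<noteq> (0 :: rat fps)"
    by simp
  ultimately have "A_hat_series oo fps_X ^ 2 = 1 / (h oo fps_X ^ 2)"
    unfolding A_hat_series_compose_square by (metis div_mult_mult1 mult.right_neutral)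
  moreover have "(h oo fps_X ^ 2) $ 0 \<noteq> 0"
    by (simp add: h_def fps_nth_compose_X_power)
  ultimately have "(A_hat_series oo fps_X ^ 2) * (h oo fps_X ^ 2) = 1"
    by (simp add: fps_divide_unit inverse_mult_eq_1)
  then have "(A_hat_series * h) oo fps_X ^ 2 = 1"
    by (simp add: fps_compose_mult_distrib)
  then have "((A_hat_series * h) oo fps_X ^ 2) $ (2 * n) = 1 $ (2 * n)" for n
    by simp
  then have "A_hat_series * h = 1"
    by (intro fps_ext) (simp add: fps_nth_compose_X_power)
  then show ?thesis by (simp add: h_def)
qed

text \<open>
  The coefficients of the truncated product and those of \<open>Q\<close> satisfy the same kind of recursion, because both series
  are inverses of series whose coefficients are known; and the coefficients in the first recursion tend to those in
  the second by \<open>coeff_euler_poly_tendsto\<close>. The truncated product uses \<open>1 / n\<^sup>2\<close> instead of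
  \<open>1 / (4 \<pi>\<^sup>2 n\<^sup>2)\<close>, so that its coefficients are rational; this substitution \<open>z \<mapsto> 4 \<pi>\<^sup>2 z\<close> is the source of
  the factor \<open>(2 \<pi>)\<^bsup>2k\<^esup>\<close>.
\<close>
lemma trunc_Q_tendsto:
  "(\<lambda>N. of_rat (trunc_Q basel N $ k)) \<longlonglongrightarrow> (2 * pi) ^ (2 * k) * of_rat (A_hat_series $ k)"
proof (induction k rule: less_induct)
  case (less k)
  let ?E = "\<lambda>i. pi ^ (2 * i) / fact (2 * i + 1)"
  let ?L = "\<lambda>i. (2 * pi) ^ (2 * i) * of_rat (A_hat_series $ i)"
  have "of_rat (trunc_Q basel N $ k) = (if k = 0 then 1 else 0)
     - (\<Sum>i=1..k. coeff (euler_poly N) i * of_rat (trunc_Q basel N $ (k - i)))" for N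
  proof -
    let ?P = "\<Prod>n=1..N. 1 + fps_const (basel n) * fps_X"
    have "?P * trunc_Q basel N = 1"
      by (simp add: trunc_Q_def inverse_mult_eq_1' flip: prod.distrib)
    then have "of_rat ((?P * trunc_Q basel N) $ k) = (if k = 0 then 1 else 0 :: real)"
      by simp
    then have "(\<Sum>i=0..k. coeff (euler_poly N) i * of_rat (trunc_Q basel N $ (k - i))) = (if k = 0 then 1 else 0)"
      by (simp add: fps_mult_nth of_rat_sum of_rat_mult coeff_euler_poly_eq[symmetric])
    then show ?thesis
      by (simp add: sum.atLeast_Suc_atMost coeff_euler_poly_0)
  qed
  moreover have "(\<lambda>N. (if k = 0 then 1 else 0)
     - (\<Sum>i=1..k. coeff (euler_poly N) i * of_rat (trunc_Q basel N $ (k - i))))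
     \<longlonglongrightarrow> (if k = 0 then 1 else 0) - (\<Sum>i=1..k. ?E i * ?L (k - i))"
    by (intro tendsto_intros coeff_euler_poly_tendsto less) auto
  moreover have "(if k = 0 then 1 else 0) - (\<Sum>i=1..k. ?E i * ?L (k - i)) = ?L k"
  proof -
    let ?h = "Abs_fps (\<lambda>n. 1 / (4 ^ n * fact (2 * n + 1))) :: rat fps"
    have "(?h * A_hat_series) $ k = (if k = 0 then 1 else 0)"
      by (subst mult.commute, subst A_hat_series_mult) simp
    then have "(\<Sum>i=0..k. of_rat (?h $ i) * of_rat (A_hat_series $ (k - i))) = (if k = 0 then 1 else 0 :: real)"
      unfolding fps_mult_nth of_rat_mult[symmetric] of_rat_sum[symmetric] by simp
    then have "(\<Sum>i=0..k. (2 * pi) ^ (2 * k) * (of_rat (?h $ i) * of_rat (A_hat_series $ (k - i)))) = (if k = 0 then 1 else 0 :: real)"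
      by (simp only: sum_distrib_left[symmetric]) simp
    also have "(\<Sum>i=0..k. (2 * pi) ^ (2 * k) * (of_rat (?h $ i) * of_rat (A_hat_series $ (k - i))))
       = (\<Sum>i=0..k. ?E i * ?L (k - i))"
    proof (intro sum.cong refl)
      fix i assume "i \<in> {0..k}"
      then have "2 * k = 2 * i + 2 * (k - i)"
        by simp
      then have "(2 * pi) ^ (2 * k) = (2 * pi) ^ (2 * i) * (2 * pi) ^ (2 * (k - i))"
        by (metis power_add)
      moreover have "(2 * pi) ^ (2 * i) * of_rat (?h $ i) = ?E i"
      proof -
        have "of_rat (fact n) = (fact n :: real)" for n
          by (metis of_nat_fact of_rat_of_nat_eq)
        then have "of_rat (?h $ i) = (1 / (4 ^ i * fact (2 * i + 1)) :: real)"
          by (simp add: of_rat_divide of_rat_mult of_rat_power del: fact_Suc)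
        then show ?thesis
          by (simp add: power_mult_distrib power_mult del: fact_Suc)
      qed
      moreover have "p * (h * q) = e * (p' * q)" if "p = c * p'" "c * h = e" for p p' c h q e :: real
        using that by auto
      ultimately show "(2 * pi) ^ (2 * k) * (of_rat (?h $ i) * of_rat (A_hat_series $ (k - i)))
          = ?E i * ?L (k - i)"
        by blast
    qed
    finally show ?thesis
      by (simp add: sum.atLeast_Suc_atMost)
  qed
  ultimately show ?case by simp
qed

section \<open>Convergence of the truncated multiple zeta sums\<close>

definition weakly_decreasing :: "nat \<Rightarrow> nat list set" where
  "weakly_decreasing r = {ns. length ns = r \<and> sorted_wrt (\<ge>) ns \<and> (\<forall>n\<in>set ns. n \<ge> 1)}"

lemma weakly_decreasing_length_0: "{ns \<in> weakly_decreasing 0. \<forall>n\<in>set ns. n \<le> N} = {[]}"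
  by (auto simp: weakly_decreasing_def)

lemma weakly_decreasing_bound_0: "{ns \<in> weakly_decreasing (Suc r). \<forall>n\<in>set ns. n \<le> 0} = {}"
  by (auto simp: weakly_decreasing_def length_Suc_conv)

lemma weakly_decreasing_bound_Suc:
  "{ns \<in> weakly_decreasing (Suc r). \<forall>n\<in>set ns. n \<le> Suc N} =
     {ns \<in> weakly_decreasing (Suc r). \<forall>n\<in>set ns. n \<le> N} \<union>
     (#) (Suc N) ` {ns \<in> weakly_decreasing r. \<forall>n\<in>set ns. n \<le> Suc N}"
proof (intro equalityI subsetI)
  fix ns assume ns: "ns \<in> {ns \<in> weakly_decreasing (Suc r). \<forall>n\<in>set ns. n \<le> Suc N}"
  then obtain n ls where [simp]: "ns = n # ls"
    by (auto simp: weakly_decreasing_def length_Suc_conv)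
  show "ns \<in> {ns \<in> weakly_decreasing (Suc r). \<forall>n\<in>set ns. n \<le> N} \<union>
     (#) (Suc N) ` {ns \<in> weakly_decreasing r. \<forall>n\<in>set ns. n \<le> Suc N}"
    using ns by (cases "n = Suc N") (auto simp: weakly_decreasing_def)
qed (auto simp: weakly_decreasing_def)

lemma finite_weakly_decreasing_bounded: "finite {ns \<in> weakly_decreasing r. \<forall>n\<in>set ns. n \<le> N}"
proof (rule finite_subset)
  show "{ns \<in> weakly_decreasing r. \<forall>n\<in>set ns. n \<le> N} \<subseteq> {ns. set ns \<subseteq> {..N} \<and> length ns = r}"
    by (auto simp: weakly_decreasing_def)
qed (simp add: finite_lists_length_eq)

lemma trunc_mzs_eq_sum:
  "trunc_mzs u N js =
     (\<Sum>ns | ns \<in> weakly_decreasing (length js) \<and> (\<forall>n\<in>set ns. n \<le> N). \<Prod>i<length js. u (ns ! i) ^ (js ! i))"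
proof (induction u N js rule: trunc_mzs.induct)
  case (1 u N)
  show ?case using weakly_decreasing_length_0[of N] by simp
next
  case (2 u j js)
  have "{ns. ns \<in> weakly_decreasing (length (j # js)) \<and> (\<forall>n\<in>set ns. n \<le> 0)} = {}"
    using weakly_decreasing_bound_0[of "length js"] by simp
  then show ?case by (simp only: trunc_mzs.simps sum.empty)
next
  case (3 u N j js)
  let ?T = "\<lambda>r N. {ns \<in> weakly_decreasing r. \<forall>n\<in>set ns. n \<le> N}"
  let ?f = "\<lambda>js ns. \<Prod>i<length js. u (ns ! i) ^ (js ! i)"
  have "sum (?f (j # js)) (?T (length (j # js)) (Suc N))
      = sum (?f (j # js)) (?T (length (j # js)) N) + sum (?f (j # js)) ((#) (Suc N) ` ?T (length js) (Suc N))"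
    unfolding list.size add_Suc_right add_0_right weakly_decreasing_bound_Suc
    by (rule sum.union_disjoint) (auto simp: finite_weakly_decreasing_bounded)
  also have "sum (?f (j # js)) ((#) (Suc N) ` ?T (length js) (Suc N))
      = u (Suc N) ^ j * sum (?f js) (?T (length js) (Suc N))"
    by (simp add: sum.reindex sum_distrib_left prod.lessThan_Suc_shift del: prod.lessThan_Suc)
  finally show ?case
    by (simp only: trunc_mzs.simps 3)
qed

lemma of_rat_trunc_mzs: "of_rat (trunc_mzs u N js) = trunc_mzs (\<lambda>n. of_rat (u n) :: real) N js"
  by (induction u N js rule: trunc_mzs.induct) (simp_all add: of_rat_add of_rat_mult of_rat_power)

lemma trunc_mzs_nonneg:
  assumes "\<And>n. u n \<ge> (0 :: real)"
  shows "trunc_mzs u N js \<ge> 0"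
  using assms by (induction u N js rule: trunc_mzs.induct) auto

text \<open>
  Dropping the condition \<open>n\<^sub>1 \<ge> n\<^sub>2\<close> makes the sum over \<open>n\<^sub>1\<close> a factor, which is at most
  \<open>suminf u\<close> because \<open>u n ^ j \<le> u n\<close>.
\<close>
lemma trunc_mzs_bounded:
  fixes u :: "nat \<Rightarrow> real"
  assumes u: "\<And>n. u n \<ge> 0" "\<And>n. u n \<le> 1" "summable u" and js: "\<forall>j\<in>set js. j \<ge> 1"
  shows "trunc_mzs u N js \<le> suminf u ^ length js"
  using js
proof (induction js arbitrary: N)
  case (Cons j js)
  let ?B = "suminf u ^ length js"
  have B: "?B \<ge> 0"
    using u by (intro zero_le_power suminf_nonneg) auto
  have "trunc_mzs u N (j # js) \<le> (\<Sum>n=1..N. u n) * ?B"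
  proof (induction N)
    case (Suc N)
    have "u (Suc N) ^ j \<le> u (Suc N)"
      using power_decreasing[of 1 j "u (Suc N)"] u Cons.prems by simp
    then have "u (Suc N) ^ j * trunc_mzs u (Suc N) js \<le> u (Suc N) * ?B"
      using Cons u trunc_mzs_nonneg[of u] by (intro mult_mono) auto
    then show ?case using Suc by (simp add: algebra_simps)
  qed simp
  also have "\<dots> \<le> suminf u * ?B"
    using u B by (intro mult_right_mono sum_le_suminf) auto
  finally show ?case by simp
qed simp

text \<open>
  All terms are nonnegative, so the bound on the truncated sums makes the series summable, and the finite
  index sets \<open>n\<^sub>1 \<le> N\<close> exhaust the index set of the series.
\<close>
lemma
  assumes js: "\<forall>j\<in>set js. j \<ge> 1"
  shows trunc_mzs_tendsto:
      "(\<lambda>N. of_rat (trunc_mzs basel N js)) \<longlonglongrightarrow> mzs (map (\<lambda>j. 2 * real j) js)"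
    and mzs_pos: "mzs (map (\<lambda>j. 2 * real j) js) > 0"
proof -
  define u where "u = (\<lambda>n. 1 / real n ^ 2)"
  define r where "r = length js"
  define T where "T = (\<lambda>N. {ns \<in> weakly_decreasing r. \<forall>n\<in>set ns. n \<le> N})"
  define f where "f = (\<lambda>ns. \<Prod>i<r. u (ns ! i) ^ (js ! i))"
  have u: "u n \<ge> 0" "u n \<le> 1" for n
    by (auto simp: u_def divide_le_eq_1 one_le_power not_less)
  have su: "summable u"
    using inverse_power_summable[of 2, where 'a = real] by (simp add: u_def field_simps)
  have tr: "of_rat (trunc_mzs basel N js) = sum f (T N)" for N
  proof -
    have "(\<lambda>n. of_rat (basel n)) = u"
      by (simp add: fun_eq_iff basel_def u_def of_rat_divide of_rat_power)
    then have "of_rat (trunc_mzs basel N js) = trunc_mzs u N js"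
      by (simp only: of_rat_trunc_mzs)
    also have "\<dots> = sum f (T N)"
      by (simp only: trunc_mzs_eq_sum f_def T_def r_def)
    finally show ?thesis .
  qed
  have mzs: "mzs (map (\<lambda>j. 2 * real j) js) = infsum f (weakly_decreasing r)"
    unfolding mzs_def weakly_decreasing_def r_def length_map
  proof (intro infsum_cong)
    fix ns :: "nat list" assume ns: "ns \<in> {ns. length ns = length js \<and> sorted_wrt (\<ge>) ns \<and> (\<forall>n\<in>set ns. 1 \<le> n)}"
    have "real (ns ! i) powr (map (\<lambda>j. 2 * real j) js ! i) = (real (ns ! i) ^ 2) ^ (js ! i)"
      if "i < length js" for i
    proof -
      have "real (ns ! i) > 0"
        using ns that nth_mem[of i ns] by fastforce
      then show ?thesis
        using that powr_realpow[of "real (ns ! i)" "2 * js ! i"] by (simp add: power_mult)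
    qed
    then show "1 / (\<Prod>i<length js. real (ns ! i) powr (map (\<lambda>j. 2 * real j) js ! i)) = f ns"
      by (simp add: f_def r_def u_def power_one_over prod_dividef)
  qed
  have fin: "finite (T N)" for N
    unfolding T_def by (rule finite_weakly_decreasing_bounded)
  have f: "f ns \<ge> 0" for ns
    unfolding f_def using u by (intro prod_nonneg) auto
  have sub: "\<exists>N. X \<subseteq> T N" if "finite X" "X \<subseteq> weakly_decreasing r" for X
  proof
    have "n \<le> Max (\<Union>(set ` X))" if "ns \<in> X" "n \<in> set ns" for n ns
      using that \<open>finite X\<close> by (intro Max_ge) auto
    then show "X \<subseteq> T (Max (\<Union>(set ` X)))"
      using that(2) by (auto simp: T_def)
  qed
  have T_mono: "T M \<subseteq> T N" if "M \<le> N" for M N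
    using that by (fastforce simp: T_def)
  have summable: "f summable_on weakly_decreasing r"
  proof (rule nonneg_bdd_above_summable_on)
    show "bdd_above (sum f ` {F. F \<subseteq> weakly_decreasing r \<and> finite F})"
    proof (rule bdd_aboveI, clarify)
      fix F assume F: "F \<subseteq> weakly_decreasing r" "finite F"
      then obtain N where "F \<subseteq> T N" using sub by blast
      then have "sum f F \<le> sum f (T N)"
        using fin f by (intro sum_mono2) auto
      also have "\<dots> = trunc_mzs u N js"
        by (simp add: trunc_mzs_eq_sum T_def f_def r_def)
      also have "\<dots> \<le> suminf u ^ length js"
        using u su js by (intro trunc_mzs_bounded)
      finally show "sum f F \<le> suminf u ^ length js" .
    qed
  qed (rule f)
  have "filterlim T (finite_subsets_at_top (weakly_decreasing r)) sequentially"
    unfolding filterlim_finite_subsets_at_top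
  proof clarify
    fix X assume "finite X" "X \<subseteq> weakly_decreasing r"
    then obtain M where "X \<subseteq> T M" using sub by blast
    then show "\<forall>\<^sub>F N in sequentially. finite (T N) \<and> X \<subseteq> T N \<and> T N \<subseteq> weakly_decreasing r"
      using T_mono fin by (intro eventually_sequentiallyI[of M]) (use T_def in blast)
  qed
  then show "(\<lambda>N. of_rat (trunc_mzs basel N js)) \<longlonglongrightarrow> mzs (map (\<lambda>j. 2 * real j) js)"
    unfolding tr mzs by (rule filterlim_compose[OF infsum_tendsto[OF summable]])
  \<comment> \<open>The term with all \<open>n\<^sub>i = 1\<close> already contributes 1.\<close>
  have "replicate r 1 \<in> weakly_decreasing r"
    by (auto simp: weakly_decreasing_def sorted_wrt_iff_nth_less)
  then have "sum f {replicate r 1} \<le> infsum f (weakly_decreasing r)"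
    using f by (intro finite_sum_le_infsum summable) auto
  moreover have "f (replicate r 1) = 1"
    by (simp add: f_def u_def)
  ultimately show "mzs (map (\<lambda>j. 2 * real j) js) > 0"
    by (simp add: mzs)
qed

section \<open>Monomials in the elementary symmetric polynomials\<close>

definition exps :: "nat list \<Rightarrow> (nat \<Rightarrow>\<^sub>0 nat)" where
  "exps js = (\<Sum>j\<leftarrow>js. Poly_Mapping.single j 1)"

lemma lookup_exps: "Poly_Mapping.lookup (exps js) i = count_list js i"
  by (induction js) (auto simp: exps_def lookup_add lookup_single when_def)

lemma exps_eq_iff: "exps js = exps ks \<longleftrightarrow> mset js = mset ks"
  by (auto simp: poly_mapping_eq_iff fun_eq_iff lookup_exps multiset_eq_iff count_mset)

lemma keys_exps: "Poly_Mapping.keys (exps js) = set js"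
  by (auto simp: in_keys_iff lookup_exps count_list_0_iff)

definition elem_monomial :: "nat \<Rightarrow> (nat \<Rightarrow>\<^sub>0 nat) \<Rightarrow> qpoly" where
  "elem_monomial m \<mu> = (\<Prod>i\<in>Poly_Mapping.keys \<mu>. elem_sym m i ^ Poly_Mapping.lookup \<mu> i)"

lemma elem_monomial_exps: "elem_monomial m (exps js) = prod_list (map (elem_sym m) js)"
proof -
  have "finite A \<Longrightarrow> set js \<subseteq> A \<Longrightarrow>
     (\<Prod>i\<in>A. elem_sym m i ^ count_list js i) = prod_list (map (elem_sym m) js)" for A
  proof (induction js)
    case (Cons j js)
    have "(\<Prod>i\<in>A. elem_sym m i ^ count_list (j # js) i)
       = (\<Prod>i\<in>A. (if i = j then elem_sym m i else 1) * elem_sym m i ^ count_list js i)"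
      by (intro prod.cong) auto
    then show ?case using Cons by (simp add: prod.distrib)
  qed simp
  then show ?thesis by (simp add: elem_monomial_def keys_exps lookup_exps)
qed

text \<open>
  The weight is the degree for the grading in which \<open>x\<^sub>j\<close> has degree \<open>j\<close>. It prefers
  variables of small index, so among the monomials of the \<open>i\<close>-th elementary symmetric polynomial it is smallest at
  \<open>x\<^sub>1 \<cdots> x\<^sub>i\<close> alone.
\<close>
definition weight :: "(nat \<Rightarrow>\<^sub>0 nat) \<Rightarrow> nat" where
  "weight \<nu> = (\<Sum>j\<in>Poly_Mapping.keys \<nu>. j * Poly_Mapping.lookup \<nu> j)"

lemma weight_superset:
  assumes "finite A" "Poly_Mapping.keys \<nu> \<subseteq> A"
  shows "weight \<nu> = (\<Sum>j\<in>A. j * Poly_Mapping.lookup \<nu> j)"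
  unfolding weight_def using assms
  by (intro sum.mono_neutral_left) (auto simp: in_keys_iff)

lemma weight_add: "weight (\<mu> + \<nu>) = weight \<mu> + weight \<nu>"
proof -
  let ?A = "Poly_Mapping.keys \<mu> \<union> Poly_Mapping.keys \<nu>"
  have "weight (\<mu> + \<nu>) = (\<Sum>j\<in>?A. j * Poly_Mapping.lookup (\<mu> + \<nu>) j)"
    by (intro weight_superset keys_add) auto
  moreover have "weight \<mu> = (\<Sum>j\<in>?A. j * Poly_Mapping.lookup \<mu> j)"
    by (intro weight_superset) auto
  moreover have "weight \<nu> = (\<Sum>j\<in>?A. j * Poly_Mapping.lookup \<nu> j)"
    by (intro weight_superset) auto
  ultimately show ?thesis
    by (simp add: lookup_add sum.distrib algebra_simps)
qed

definition lowest_term :: "(nat \<Rightarrow>\<^sub>0 nat) \<Rightarrow> qpoly \<Rightarrow> bool" where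
  "lowest_term \<nu> P \<longleftrightarrow> Poly_Mapping.lookup P \<nu> = 1 \<and>
     (\<forall>\<eta>\<in>Poly_Mapping.keys P. \<eta> \<noteq> \<nu> \<longrightarrow> weight \<nu> < weight \<eta>)"

lemma lowest_term_one: "lowest_term 0 1"
  by (simp add: lowest_term_def)

text \<open>
  Weights add up when monomials are multiplied, so the only pair of monomials of \<open>P\<close> and \<open>Q\<close> with product
  of weight at most \<open>weight \<mu> + weight \<nu>\<close> is \<open>(\<mu>, \<nu>)\<close> itself.
\<close>
lemma lowest_term_mult:
  assumes P: "lowest_term \<mu> P" and Q: "lowest_term \<nu> Q"
  shows "lowest_term (\<mu> + \<nu>) (P * Q)"
proof -
  \<comment> \<open>Split \<open>Q\<close> into its lowest term and terms of larger weight, which cannot contribute at \<open>\<mu> + \<nu>\<close>.\<close>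
  let ?x = "Poly_Mapping.single \<nu> 1 :: qpoly"
  have "Poly_Mapping.lookup (P * (Q - ?x)) (\<mu> + \<nu>) = 0"
  proof (rule ccontr)
    assume "\<not> ?thesis"
    then have "\<mu> + \<nu> \<in> Poly_Mapping.keys (P * (Q - ?x))"
      by (simp add: in_keys_iff)
    then obtain a b where ab: "a \<in> Poly_Mapping.keys P" "b \<in> Poly_Mapping.keys (Q - ?x)" "\<mu> + \<nu> = a + b"
      using keys_mult[of P "Q - ?x"] by blast
    from ab(2) Q have "b \<noteq> \<nu>" "b \<in> Poly_Mapping.keys Q"
      by (auto simp: in_keys_iff lookup_minus lookup_single when_def lowest_term_def split: if_splits)
    then have "weight \<nu> < weight b"
      using Q by (auto simp: lowest_term_def)
    moreover have "weight \<mu> \<le> weight a"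
      using P ab(1) by (cases "a = \<mu>") (auto simp: lowest_term_def intro: less_imp_le)
    ultimately show False
      using arg_cong[OF ab(3), of weight] by (simp add: weight_add)
  qed
  moreover have "P * Q = P * ?x + P * (Q - ?x)"
    by (simp add: algebra_simps)
  ultimately have "Poly_Mapping.lookup (P * Q) (\<mu> + \<nu>) = 1"
    using P by (simp add: lookup_add lookup_mult_single lowest_term_def)
  moreover have "weight (\<mu> + \<nu>) < weight \<eta>"
    if \<eta>: "\<eta> \<in> Poly_Mapping.keys (P * Q)" "\<eta> \<noteq> \<mu> + \<nu>" for \<eta>
  proof -
    obtain a b where ab: "a \<in> Poly_Mapping.keys P" "b \<in> Poly_Mapping.keys Q" "\<eta> = a + b"
      using \<eta>(1) keys_mult[of P Q] by blast
    then have "a \<noteq> \<mu> \<or> b \<noteq> \<nu>"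
      using \<eta>(2) by auto
    moreover have "a = \<mu> \<or> weight \<mu> < weight a" "b = \<nu> \<or> weight \<nu> < weight b"
      using P Q ab by (auto simp: lowest_term_def)
    ultimately show ?thesis
      by (auto simp: weight_add ab(3))
  qed
  ultimately show ?thesis
    by (simp add: lowest_term_def)
qed

lemma lowest_term_prod:
  assumes "\<And>i. i \<in> A \<Longrightarrow> lowest_term (\<nu> i) (P i)"
  shows "lowest_term (sum \<nu> A) (prod P A)"
  using assms
  by (induction A rule: infinite_finite_induct) (auto intro: lowest_term_one lowest_term_mult)

lemma lookup_sum_single:
  assumes "finite J"
  shows "Poly_Mapping.lookup (\<Sum>j\<in>J. Poly_Mapping.single j (c::nat)) i = (if i \<in> J then c else 0)"
  using assms by (simp add: lookup_sum lookup_single when_def)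

text \<open>
  Replacing the elements of \<open>J\<close> that exceed \<open>card J\<close> by the equally many missing numbers from 1 to \<open>card J\<close> makes
  the sum smaller.
\<close>
lemma sum_initial_segment_less:
  assumes "finite J" "0 \<notin> J" "J \<noteq> {1..card J}"
  shows "\<Sum>{1..card J} < \<Sum>J"
proof -
  let ?A = "{1..card J}"
  have c: "card (J - ?A) = card (?A - J)"
    using card_Diff_subset_Int[of J ?A] card_Diff_subset_Int[of ?A J] assms(1)
    by (simp add: Int_commute)
  have "J - ?A \<noteq> {}"
  proof
    assume "J - ?A = {}"
    then have "J \<subseteq> ?A" by blast
    then have "J = ?A" by (intro card_subset_eq) auto
    with assms(3) show False by blast
  qed
  then have pos: "card (J - ?A) > 0"
    using assms(1) by (simp add: card_gt_0_iff)
  have "\<Sum>?A = \<Sum>(J \<inter> ?A) + \<Sum>(?A - J)"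
    using sum.Int_Diff[of ?A "\<lambda>x. x" J] by (simp add: Int_commute)
  also have "\<Sum>(?A - J) \<le> card (?A - J) * card J"
    using sum_bounded_above[of "?A - J" "\<lambda>x. x" "card J"] by auto
  also have "\<dots> < card (J - ?A) * (card J + 1)"
    using pos c by simp
  also have "\<dots> \<le> \<Sum>(J - ?A)"
  proof -
    have "card J + 1 \<le> j" if "j \<in> J - ?A" for j
      using that assms(2) by (cases j) auto
    then show ?thesis
      using sum_bounded_below[of "J - ?A" "card J + 1" "\<lambda>x. x"] by auto
  qed
  also have "\<Sum>(J \<inter> ?A) + \<Sum>(J - ?A) = \<Sum>J"
    using sum.Int_Diff[of J "\<lambda>x. x" ?A] assms(1) by simp
  finally show ?thesis by simp
qed

lemma lowest_term_elem_sym: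
  assumes "i \<le> m"
  shows "lowest_term (\<Sum>j=1..i. Poly_Mapping.single j 1) (elem_sym m i)"
proof -
  let ?F = "{J. J \<subseteq> {1..m} \<and> card J = i}"
  define ind where "ind = (\<lambda>J :: nat set. \<Sum>j\<in>J. Poly_Mapping.single j (1::nat))"
  have fin: "finite J" if "J \<in> ?F" for J
    using that by (auto intro: finite_subset)
  have finF: "finite ?F"
    by (rule finite_subset[of _ "Pow {1..m}"]) auto
  have "(\<Prod>j\<in>J. var j) = Poly_Mapping.single (ind J) 1" for J
    by (induction J rule: infinite_finite_induct) (simp_all add: ind_def var_def mult_single)
  then have e: "elem_sym m i = (\<Sum>J\<in>?F. Poly_Mapping.single (ind J) 1)"
    by (simp add: elem_sym_def)
  have inj: "J = J'" if "ind J = ind J'" "finite J" "finite J'" for J J'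
  proof -
    have "j \<in> J \<longleftrightarrow> j \<in> J'" for j
      using arg_cong[OF that(1), of "\<lambda>p. Poly_Mapping.lookup p j"] that(2,3)
      by (simp add: ind_def lookup_sum_single split: if_splits)
    then show ?thesis by blast
  qed
  have w: "weight (ind J) = \<Sum>J" if "finite J" for J
    using that by (subst weight_superset[of J]) (auto simp: ind_def lookup_sum_single in_keys_iff split: if_splits)
  have "Poly_Mapping.lookup (elem_sym m i) (ind {1..i}) = (\<Sum>J\<in>?F. if J = {1..i} then 1 else 0)"
    unfolding e lookup_sum
  proof (intro sum.cong refl)
    fix J assume "J \<in> ?F"
    then have "ind J = ind {1..i} \<longleftrightarrow> J = {1..i}"
      using inj[of J "{1..i}"] fin by blast
    then show "Poly_Mapping.lookup (Poly_Mapping.single (ind J) 1) (ind {1..i}) = (if J = {1..i} then 1 else 0)"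
      by (simp add: lookup_single when_def)
  qed
  also have "\<dots> = 1"
    using finF assms by simp
  finally have "Poly_Mapping.lookup (elem_sym m i) (ind {1..i}) = 1" .
  moreover have "weight (ind {1..i}) < weight \<eta>"
    if \<eta>: "\<eta> \<in> Poly_Mapping.keys (elem_sym m i)" "\<eta> \<noteq> ind {1..i}" for \<eta>
  proof -
    obtain J where J: "J \<in> ?F" "\<eta> = ind J"
      using \<eta>(1) keys_sum[of "\<lambda>J. Poly_Mapping.single (ind J) 1" ?F] unfolding e by auto
    have "card J = i" "0 \<notin> J"
      using J(1) by auto
    then have "J \<noteq> {1..card J}"
      using \<eta>(2) J(2) by metis
    then have "\<Sum>{1..card J} < \<Sum>J"
      using fin[OF J(1)] \<open>0 \<notin> J\<close> by (intro sum_initial_segment_less)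
    then show ?thesis
      unfolding J(2) w[OF fin[OF J(1)]] w[OF finite_atLeastAtMost] \<open>card J = i\<close> .
  qed
  ultimately show ?thesis
    by (simp add: lowest_term_def ind_def)
qed

text \<open>
  The exponents of \<open>\<Prod>i. (x\<^sub>1 \<cdots> x\<^sub>i)\<^bsup>\<mu> i\<^esup>\<close>, the product of the lowest monomials of the
  factors of \<open>elem_monomial m \<mu>\<close>.
\<close>
definition lowest_exps :: "nat \<Rightarrow> (nat \<Rightarrow>\<^sub>0 nat) \<Rightarrow> (nat \<Rightarrow>\<^sub>0 nat)" where
  "lowest_exps m \<mu> = (\<Sum>i=1..m. \<Sum>j=1..i. Poly_Mapping.single j (Poly_Mapping.lookup \<mu> i))"

lemma lowest_term_elem_monomial:
  assumes "Poly_Mapping.keys \<mu> \<subseteq> {1..m}"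
  shows "lowest_term (lowest_exps m \<mu>) (elem_monomial m \<mu>)"
proof -
  have "lowest_term (\<Sum>j=1..i. Poly_Mapping.single j n) (elem_sym m i ^ n)" if "i \<le> m" for i n
  proof (induction n)
    case (Suc n)
    then have "lowest_term ((\<Sum>j=1..i. Poly_Mapping.single j 1) + (\<Sum>j=1..i. Poly_Mapping.single j n))
       (elem_sym m i * elem_sym m i ^ n)"
      using that by (intro lowest_term_mult lowest_term_elem_sym)
    then show ?case
      by (simp add: sum.distrib[symmetric] single_add[symmetric])
  qed (simp add: lowest_term_one)
  then have "lowest_term (lowest_exps m \<mu>) (\<Prod>i=1..m. elem_sym m i ^ Poly_Mapping.lookup \<mu> i)"
    unfolding lowest_exps_def by (intro lowest_term_prod) auto
  also have "(\<Prod>i=1..m. elem_sym m i ^ Poly_Mapping.lookup \<mu> i) = elem_monomial m \<mu>"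
    unfolding elem_monomial_def using assms
    by (intro prod.mono_neutral_right) (auto simp: in_keys_iff)
  finally show ?thesis .
qed

text \<open>
  The exponent of \<open>x\<^sub>j\<close> is \<open>\<mu> j + \<mu> (j + 1) + \<cdots> + \<mu> m\<close>, so \<open>\<mu> j\<close> is the difference of two
  consecutive exponents.
\<close>
lemma lowest_exps_inject:
  assumes "lowest_exps m \<mu> = lowest_exps m \<nu>"
    and "Poly_Mapping.keys \<mu> \<subseteq> {1..m}" "Poly_Mapping.keys \<nu> \<subseteq> {1..m}"
  shows "\<mu> = \<nu>"
proof (rule poly_mapping_eqI)
  fix j
  have lowest: "Poly_Mapping.lookup (lowest_exps m \<mu>) j = (\<Sum>i=j..m. Poly_Mapping.lookup \<mu> i)" if "j \<ge> 1" for \<mu> j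
  proof -
    have "Poly_Mapping.lookup (lowest_exps m \<mu>) j = (\<Sum>i=1..m. if i \<in> {j..m} then Poly_Mapping.lookup \<mu> i else 0)"
      unfolding lowest_exps_def lookup_sum[of _ "{1..m}"] using that
      by (intro sum.cong) (auto simp: lookup_sum_single)
    also have "\<dots> = (\<Sum>i\<in>{1..m} \<inter> {j..m}. Poly_Mapping.lookup \<mu> i)"
      by (subst sum.inter_restrict) auto
    also have "{1..m} \<inter> {j..m} = {j..m}"
      using that by auto
    finally show ?thesis .
  qed
  show "Poly_Mapping.lookup \<mu> j = Poly_Mapping.lookup \<nu> j"
  proof (cases "j \<in> {1..m}")
    case True
    have "(\<Sum>i=l..m. Poly_Mapping.lookup \<mu> i) = (\<Sum>i=l..m. Poly_Mapping.lookup \<nu> i)" if "l \<ge> 1" for l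
      using assms(1) that by (simp flip: lowest)
    from this[of j] this[of "Suc j"] True show ?thesis
      by (simp add: sum.atLeast_Suc_atMost)
  next
    case False
    then have "j \<notin> Poly_Mapping.keys \<mu>" "j \<notin> Poly_Mapping.keys \<nu>"
      using assms(2,3) by blast+
    then show ?thesis by (simp add: in_keys_iff)
  qed
qed

text \<open>
  Reading the combination at the lowest monomial of \<open>elem_monomial m \<mu>\<close> gives \<open>c \<mu>\<close> plus rational multiples of
  coefficients whose own lowest monomial has smaller weight; induct on this weight. With \<open>V = {0}\<close> this is the
  algebraic independence of the elementary symmetric polynomials, and with \<open>V = \<rat>\<close> it says that a real
  combination of products of elementary symmetric polynomials which is a rational polynomial has rational
  coefficients.
\<close>
lemma elem_monomial_coefficients_in_subspace:
  fixes c :: "(nat \<Rightarrow>\<^sub>0 nat) \<Rightarrow> real" and V :: "real set"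
  assumes K: "finite K" "\<And>\<mu>. \<mu> \<in> K \<Longrightarrow> Poly_Mapping.keys \<mu> \<subseteq> {1..m}"
    and V: "0 \<in> V" "\<And>a b. a \<in> V \<Longrightarrow> b \<in> V \<Longrightarrow> a + b \<in> V" "\<And>q a. a \<in> V \<Longrightarrow> a * of_rat q \<in> V"
    and c: "\<And>\<nu>. (\<Sum>\<mu>\<in>K. c \<mu> * of_rat (Poly_Mapping.lookup (elem_monomial m \<mu>) \<nu>)) \<in> V"
    and "\<mu> \<in> K"
  shows "c \<mu> \<in> V"
  using \<open>\<mu> \<in> K\<close>
proof (induction "weight (lowest_exps m \<mu>)" arbitrary: \<mu> rule: less_induct)
  case less
  let ?M = "\<lambda>\<mu>'. of_rat (Poly_Mapping.lookup (elem_monomial m \<mu>') (lowest_exps m \<mu>)) :: real"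
  have sum_closed: "sum f A \<in> V" if "\<And>a. a \<in> A \<Longrightarrow> f a \<in> V" for f :: "_ \<Rightarrow> real" and A :: "(nat \<Rightarrow>\<^sub>0 nat) set"
    using that V(1,2) by (induction A rule: infinite_finite_induct) auto
  have "c \<mu>' * ?M \<mu>' \<in> V" if "\<mu>' \<in> K - {\<mu>}" for \<mu>'
  proof (cases "?M \<mu>' = 0")
    case False
    have "lowest_exps m \<mu>' \<noteq> lowest_exps m \<mu>"
      using that less.prems K(2) lowest_exps_inject[of m \<mu>' \<mu>] by blast
    then have "weight (lowest_exps m \<mu>') < weight (lowest_exps m \<mu>)"
      using lowest_term_elem_monomial[of \<mu>' m] that K(2) False
      by (auto simp: lowest_term_def in_keys_iff)
    then show ?thesis using that by (intro V(3) less.hyps) auto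
  qed (simp add: V(1))
  then have rest: "(\<Sum>\<mu>'\<in>K - {\<mu>}. c \<mu>' * ?M \<mu>') \<in> V"
    by (rule sum_closed)
  have "(\<Sum>\<mu>'\<in>K. c \<mu>' * ?M \<mu>') + (\<Sum>\<mu>'\<in>K - {\<mu>}. c \<mu>' * ?M \<mu>') * of_rat (-1) \<in> V"
    by (intro V(2) V(3) c rest)
  moreover have "(\<Sum>\<mu>'\<in>K. c \<mu>' * ?M \<mu>') = c \<mu> * ?M \<mu> + (\<Sum>\<mu>'\<in>K - {\<mu>}. c \<mu>' * ?M \<mu>')"
    using less.prems K(1) by (rule sum.remove[rotated])
  moreover have "?M \<mu> = 1"
    using lowest_term_elem_monomial[of \<mu> m] K(2) less.prems by (simp add: lowest_term_def)
  ultimately show ?case by simp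
qed

section \<open>The coefficients of the A-hat polynomials\<close>

text \<open>
  The limit of \<open>prod_trunc_Q\<close> at the monomial \<open>\<nu>\<close>. In degree \<open>k\<close> the factors
  \<open>(2 \<pi>)\<^bsup>2 i\<^esup>\<close> of \<open>trunc_Q_tendsto\<close> combine to \<open>(2 \<pi>)\<^bsup>2 k\<^esup>\<close>, as the exponents of
  \<open>\<nu>\<close> add up to \<open>k\<close>.
\<close>
lemma Q_prod_part_expansion:
  "(\<Sum>js\<in>compositions k. (-1) ^ length js * mzs (map (\<lambda>j. 2 * real j) js) / (2 * pi) ^ (2 * k)
       * of_rat (Poly_Mapping.lookup (elem_monomial m (exps js)) \<nu>))
   = of_rat (Poly_Mapping.lookup (Q_prod_part m k) \<nu>)"
proof -
  let ?mzs = "\<lambda>js. mzs (map (\<lambda>j. 2 * real j) js)"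
  let ?M = "\<lambda>js. of_rat (Poly_Mapping.lookup (elem_monomial m (exps js)) \<nu>) :: real"
  define a where "a = (\<lambda>N. of_rat (Poly_Mapping.lookup ((\<Prod>i=1..m. series_at (trunc_Q basel N) (var i)) $ k) \<nu>) :: real)"
  have "a = (\<lambda>N. \<Sum>js\<in>compositions k. (-1) ^ length js * of_rat (trunc_mzs basel N js) * ?M js)"
    unfolding a_def prod_trunc_Q comp_series_def
    by (simp add: lookup_sum lookup_qconst_mult of_rat_sum of_rat_mult of_rat_power elem_monomial_exps)
  moreover have "(\<lambda>N. \<Sum>js\<in>compositions k. (-1) ^ length js * of_rat (trunc_mzs basel N js) * ?M js)
      \<longlonglongrightarrow> (\<Sum>js\<in>compositions k. (-1) ^ length js * ?mzs js * ?M js)"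
    by (intro tendsto_intros trunc_mzs_tendsto) (auto simp: compositions_def)
  ultimately have lim1: "a \<longlonglongrightarrow> (\<Sum>js\<in>compositions k. (-1) ^ length js * ?mzs js * ?M js)"
    by simp
  have lim2: "a \<longlonglongrightarrow> (2 * pi) ^ (2 * k) * of_rat (Poly_Mapping.lookup (Q_prod_part m k) \<nu>)"
  proof (cases "Poly_Mapping.keys \<nu> \<subseteq> {1..m} \<and> deg_mono \<nu> = k")
    case True
    have of_rat_prod: "of_rat (\<Prod>i\<in>A. f i) = (\<Prod>i\<in>A. of_rat (f i) :: real)" for f :: "nat \<Rightarrow> rat" and A
      by (induction A rule: infinite_finite_induct) (simp_all add: of_rat_mult)
    have k: "(\<Sum>i=1..m. Poly_Mapping.lookup \<nu> i) = k"
      using True deg_mono_superset[of "{1..m}" \<nu>] by simp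
    have "a = (\<lambda>N. \<Prod>i=1..m. of_rat (trunc_Q basel N $ Poly_Mapping.lookup \<nu> i))"
      unfolding a_def lookup_prod_series_at if_P[OF True] of_rat_prod ..
    moreover have "(\<lambda>N. \<Prod>i=1..m. of_rat (trunc_Q basel N $ Poly_Mapping.lookup \<nu> i)) \<longlonglongrightarrow>
       (\<Prod>i=1..m. (2 * pi) ^ (2 * Poly_Mapping.lookup \<nu> i) * of_rat (A_hat_series $ Poly_Mapping.lookup \<nu> i))"
      by (intro tendsto_prod trunc_Q_tendsto)
    moreover have "(\<Prod>i=1..m. (2 * pi) ^ (2 * Poly_Mapping.lookup \<nu> i) * of_rat (A_hat_series $ Poly_Mapping.lookup \<nu> i))
      = (2 * pi) ^ (2 * k) * of_rat (Poly_Mapping.lookup (Q_prod_part m k) \<nu>)"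
      using True by (simp only: prod.distrib power_sum[symmetric] sum_distrib_left[symmetric] k
          Q_prod_part_eq lookup_prod_series_at of_rat_prod if_True simp_thms)
    ultimately show ?thesis by simp
  next
    case False
    then have "Poly_Mapping.lookup (Q_prod_part m k) \<nu> = 0"
      unfolding Q_prod_part_eq lookup_prod_series_at by (rule if_not_P)
    moreover have "a = (\<lambda>N. 0)"
      unfolding a_def lookup_prod_series_at if_not_P[OF False] by simp
    ultimately show ?thesis by simp
  qed
  have "(\<Sum>js\<in>compositions k. (-1) ^ length js * ?mzs js * ?M js)
      = (2 * pi) ^ (2 * k) * of_rat (Poly_Mapping.lookup (Q_prod_part m k) \<nu>)"
    using lim1 lim2 by (rule LIMSEQ_unique)
  then have "of_rat (Poly_Mapping.lookup (Q_prod_part m k) \<nu>)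
      = (\<Sum>js\<in>compositions k. (-1) ^ length js * ?mzs js * ?M js) / (2 * pi) ^ (2 * k)"
    by simp
  then show ?thesis
    by (simp only: sum_divide_distrib times_divide_eq_left)
qed

lemma poly_subst_superset:
  assumes "finite K" "Poly_Mapping.keys P \<subseteq> K"
  shows "poly_subst (elem_sym m) P = (\<Sum>\<mu>\<in>K. qconst (Poly_Mapping.lookup P \<mu>) * elem_monomial m \<mu>)"
  unfolding poly_subst_def elem_monomial_def[symmetric] using assms
  by (intro sum.mono_neutral_left) (auto simp: in_keys_iff)

text \<open>
  Algebraic independence of the first \<open>m\<close> elementary symmetric polynomials in \<open>m\<close> variables, hence the
  uniqueness in the definition of \<open>A_hat\<close>.
\<close>
lemma poly_subst_elem_sym_inject:
  assumes "indets P \<subseteq> {1..m}" "indets P' \<subseteq> {1..m}"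
    and "poly_subst (elem_sym m) P = poly_subst (elem_sym m) P'"
  shows "P = P'"
proof (rule poly_mapping_eqI)
  fix \<mu>
  let ?K = "Poly_Mapping.keys P \<union> Poly_Mapping.keys P'"
  let ?c = "\<lambda>\<mu>. of_rat (Poly_Mapping.lookup P \<mu> - Poly_Mapping.lookup P' \<mu>) :: real"
  show "Poly_Mapping.lookup P \<mu> = Poly_Mapping.lookup P' \<mu>"
  proof (cases "\<mu> \<in> ?K")
    case True
    have "?c \<mu> \<in> {0}"
    proof (rule elem_monomial_coefficients_in_subspace[where K = ?K and m = m])
      show "Poly_Mapping.keys \<mu> \<subseteq> {1..m}" if "\<mu> \<in> ?K" for \<mu>
        using that assms(1,2) by (auto simp: indets_def)
      fix \<nu>
      have "(\<Sum>\<mu>\<in>?K. ?c \<mu> * of_rat (Poly_Mapping.lookup (elem_monomial m \<mu>) \<nu>))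
        = of_rat (Poly_Mapping.lookup (poly_subst (elem_sym m) P - poly_subst (elem_sym m) P') \<nu>)"
        by (simp add: poly_subst_superset[of ?K] lookup_minus lookup_sum lookup_qconst_mult
            sum_subtractf[symmetric] of_rat_sum of_rat_mult of_rat_diff left_diff_distrib)
      then show "(\<Sum>\<mu>\<in>?K. ?c \<mu> * of_rat (Poly_Mapping.lookup (elem_monomial m \<mu>) \<nu>)) \<in> {0}"
        by (simp add: assms(3))
    qed (use True in auto)
    then show ?thesis by simp
  qed (simp add: in_keys_iff)
qed

text \<open>
  The coefficients of \<open>Q_prod_part_expansion\<close>, collected by monomials, are rational and so define a polynomial with the
  property that characterises \<open>A_hat k\<close>.
\<close>
lemma coeff_A_hat:
  assumes "js \<in> compositions k"
  shows "of_rat (coeff_at (A_hat k) js) =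
    (\<Sum>ks | ks \<in> compositions k \<and> mset ks = mset js.
       (-1) ^ length ks * mzs (map (\<lambda>j. 2 * real j) ks) / (2 * pi) ^ (2 * k))"
proof -
  let ?b = "\<lambda>ks. (-1) ^ length ks * mzs (map (\<lambda>j. 2 * real j) ks) / (2 * pi) ^ (2 * k)"
  let ?M = "\<lambda>m \<nu> \<mu>. of_rat (Poly_Mapping.lookup (elem_monomial m \<mu>) \<nu>) :: real"
  \<comment> \<open>Compositions with the same parts give the same product of elementary symmetric polynomials; \<open>c\<close> adds up their coefficients.\<close>
  define K where "K = exps ` compositions k"
  define c where "c = (\<lambda>\<mu>. \<Sum>ks | ks \<in> compositions k \<and> exps ks = \<mu>. ?b ks)"
  have finK: "finite K" by (simp add: K_def)
  have keys: "Poly_Mapping.keys \<mu> \<subseteq> {1..k}" if \<mu>: "\<mu> \<in> K" for \<mu>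
  proof -
    obtain ks where "\<mu> = exps ks" "ks \<in> compositions k"
      using \<mu> by (auto simp: K_def)
    then show ?thesis
      using member_le_sum_list[of _ ks] by (auto simp: keys_exps compositions_def)
  qed
  have c: "(\<Sum>\<mu>\<in>K. c \<mu> * ?M m \<nu> \<mu>) = of_rat (Poly_Mapping.lookup (Q_prod_part m k) \<nu>)" for m \<nu>
  proof -
    have "(\<Sum>\<mu>\<in>K. c \<mu> * ?M m \<nu> \<mu>) = (\<Sum>\<mu>\<in>K. \<Sum>ks | ks \<in> compositions k \<and> exps ks = \<mu>. ?b ks * ?M m \<nu> (exps ks))"
      unfolding c_def sum_distrib_right by (intro sum.cong) auto
    also have "\<dots> = (\<Sum>ks\<in>compositions k. ?b ks * ?M m \<nu> (exps ks))"
      unfolding K_def by (rule sum.image_gen[symmetric]) simp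
    also have "\<dots> = of_rat (Poly_Mapping.lookup (Q_prod_part m k) \<nu>)"
      by (rule Q_prod_part_expansion)
    finally show ?thesis .
  qed
  have "c \<mu> \<in> \<rat>" if "\<mu> \<in> K" for \<mu>
    using finK keys _ _ _ _ that
  proof (rule elem_monomial_coefficients_in_subspace)
    show "(\<Sum>\<mu>\<in>K. c \<mu> * ?M k \<nu> \<mu>) \<in> \<rat>" for \<nu>
      unfolding c by simp
  qed auto
  then have "\<forall>\<mu>\<in>K. \<exists>q. c \<mu> = of_rat q"
    by (auto simp: Rats_def)
  then obtain r where r: "\<And>\<mu>. \<mu> \<in> K \<Longrightarrow> c \<mu> = of_rat (r \<mu>)"
    by metis
  define P :: qpoly where "P = (\<Sum>\<mu>\<in>K. Poly_Mapping.single \<mu> (r \<mu>))"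
  have P: "Poly_Mapping.lookup P \<mu> = (if \<mu> \<in> K then r \<mu> else 0)" for \<mu>
    using finK by (simp add: P_def lookup_sum lookup_single when_def)
  have keysP: "Poly_Mapping.keys P \<subseteq> K"
    by (auto simp: in_keys_iff P split: if_splits)
  have indets: "indets P \<subseteq> {1..k}"
    using keysP keys by (auto simp: indets_def)
  have subst: "poly_subst (elem_sym m) P = Q_prod_part m k" for m
  proof (rule poly_mapping_eqI)
    fix \<nu>
    have "of_rat (Poly_Mapping.lookup (poly_subst (elem_sym m) P) \<nu>) = (\<Sum>\<mu>\<in>K. c \<mu> * ?M m \<nu> \<mu>)"
      by (simp add: poly_subst_superset[OF finK keysP] lookup_sum lookup_qconst_mult P r
          of_rat_sum of_rat_mult)
    then show "Poly_Mapping.lookup (poly_subst (elem_sym m) P) \<nu> = Poly_Mapping.lookup (Q_prod_part m k) \<nu>"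
      by (simp add: c)
  qed
  have "A_hat k = P"
    unfolding A_hat_def
  proof (rule the_equality)
    show "indets P \<subseteq> {1..k} \<and> (\<forall>m\<ge>k. poly_subst (elem_sym m) P = Q_prod_part m k)"
      by (intro conjI allI impI indets subst)
    show "P' = P" if "indets P' \<subseteq> {1..k} \<and> (\<forall>m\<ge>k. poly_subst (elem_sym m) P' = Q_prod_part m k)" for P'
    proof (rule poly_subst_elem_sym_inject[of _ k])
      show "poly_subst (elem_sym k) P' = poly_subst (elem_sym k) P"
        unfolding subst by (rule that[THEN conjunct2, rule_format, OF order_refl])
    qed (use that indets in blast)+
  qed
  moreover have "exps js \<in> K"
    using assms by (simp add: K_def)
  ultimately have "of_rat (coeff_at (A_hat k) js) = c (exps js)"
    unfolding coeff_at_def exps_def[symmetric] by (simp add: P r)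
  then show ?thesis
    by (simp add: c_def exps_eq_iff)
qed

section \<open>Rearrangements of a partition\<close>

text \<open>
  The permutations that produce a given rearrangement of \<open>xs\<close> form a coset of the stabiliser of \<open>xs\<close>. All
  rearrangements are therefore obtained equally often, and comparing the number of permutations with the number of
  rearrangements gives the product of factorials.
\<close>
lemma sum_permute_list:
  fixes F :: "'a list \<Rightarrow> 'b::comm_semiring_1"
  shows "(\<Sum>\<sigma> | \<sigma> permutes {..<length xs}. F (permute_list \<sigma> xs))
     = of_nat (\<Prod>x\<in>set xs. fact (count_list xs x)) * (\<Sum>ys\<in>permutations_of_multiset (mset xs). F ys)"
proof -
  let ?S = "{\<sigma>. \<sigma> permutes {..<length xs}}"
  let ?Y = "permutations_of_multiset (mset xs)"
  \<comment> \<open>The permutations that turn \<open>xs\<close> into \<open>ys\<close>; composition with one that does carries \<open>fib xs\<close> to \<open>fib ys\<close>.\<close>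
  define fib where "fib = (\<lambda>ys. {\<sigma> \<in> ?S. permute_list \<sigma> xs = ys})"
  have finS: "finite ?S"
    by (rule finite_permutations) simp
  have img: "(\<lambda>\<sigma>. permute_list \<sigma> xs) ` ?S \<subseteq> ?Y"
    by (auto intro!: permutations_of_multisetI)
  have fib: "card (fib ys) = card (fib xs)" if "ys \<in> ?Y" for ys
  proof -
    have "mset ys = mset xs" using that by (rule permutations_of_multisetD)
    then obtain \<tau> where \<tau>: "\<tau> permutes {..<length xs}" "permute_list \<tau> xs = ys"
      by (rule mset_eq_permutation)
    have inv: "inv \<tau> permutes {..<length xs}" using \<tau>(1) by (rule permutes_inv)
    have xs: "permute_list (inv \<tau>) ys = xs"
      using permute_list_compose[OF inv, of \<tau>] permutes_inv_o(1)[OF \<tau>(1)] \<tau>(2) by simp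
    have "bij_betw (\<lambda>\<sigma>. \<sigma> \<circ> \<tau>) (fib xs) (fib ys)"
    proof (rule bij_betwI[where g = "\<lambda>\<sigma>. \<sigma> \<circ> inv \<tau>"])
      show "(\<lambda>\<sigma>. \<sigma> \<circ> \<tau>) \<in> fib xs \<rightarrow> fib ys"
        using \<tau> by (auto simp: fib_def permutes_compose permute_list_compose)
      show "(\<lambda>\<sigma>. \<sigma> \<circ> inv \<tau>) \<in> fib ys \<rightarrow> fib xs"
        using inv xs by (auto simp: fib_def permutes_compose permute_list_compose)
    qed (use permutes_inv_o[OF \<tau>(1)] in \<open>auto simp: comp_assoc\<close>)
    then show ?thesis by (rule bij_betw_same_card[symmetric])
  qed
  have sum: "(\<Sum>\<sigma>\<in>?S. G (permute_list \<sigma> xs)) = of_nat (card (fib xs)) * (\<Sum>ys\<in>?Y. G ys)"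
    for G :: "'a list \<Rightarrow> 'c::comm_semiring_1"
  proof -
    have "(\<Sum>\<sigma>\<in>?S. G (permute_list \<sigma> xs)) = (\<Sum>ys\<in>?Y. \<Sum>\<sigma>\<in>fib ys. G (permute_list \<sigma> xs))"
      unfolding fib_def using finS img by (intro sum.group[symmetric]) auto
    also have "\<dots> = (\<Sum>ys\<in>?Y. of_nat (card (fib xs)) * G ys)"
      using fib by (intro sum.cong) (auto simp: fib_def)
    finally show ?thesis by (simp add: sum_distrib_left)
  qed
  have "card (fib xs) * card ?Y = fact (length xs)"
    using sum[of "\<lambda>_. 1 :: nat"] by (simp add: card_permutations[OF refl])
  also have "\<dots> = (\<Prod>x\<in>set xs. fact (count_list xs x)) * card ?Y"
    using card_permutations_of_multiset_aux[of "mset xs"] by (simp add: count_mset mult.commute)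
  finally have "card (fib xs) = (\<Prod>x\<in>set xs. fact (count_list xs x))"
    by (simp add: card_eq_0_iff)
  then show ?thesis
    using sum[of F] by simp
qed

lemma permutations_of_multiset_compositions:
  assumes "js \<in> compositions k"
  shows "permutations_of_multiset (mset js) = {ks \<in> compositions k. mset ks = mset js}"
proof -
  have "ks \<in> compositions k" if "mset ks = mset js" for ks
    using assms mset_eq_setD[OF that] arg_cong[OF that, of sum_mset]
    by (auto simp: compositions_def sum_mset_sum_list)
  then show ?thesis by (auto simp: permutations_of_multiset_def)
qed

theorem theorem4:
  fixes k :: nat and js :: "nat list"
  assumes "k \<ge> 1" and "is_partition js k"
  shows "of_rat (coeff_at (A_hat k) js) =
           (-1) ^ length js / (\<Prod>l=1..k. fact (count_list js l)) * (1 / (2 * pi) ^ (2 * k))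
             * mzs_sym (map (\<lambda>j. 2 * real j) js)
         \<and> (odd (length js) \<longrightarrow> coeff_at (A_hat k) js < 0)
         \<and> (even (length js) \<longrightarrow> coeff_at (A_hat k) js > 0)"
proof -
  let ?g = "\<lambda>j. 2 * real j"
  define A where "A = mzs_sym (map ?g js)"
  define D :: real where "D = (\<Prod>l=1..k. fact (count_list js l))"
  have js: "js \<in> compositions k"
    using assms(2) by (simp add: compositions_def is_partition_def)
  have pos: "\<forall>j\<in>set js. j \<ge> 1"
    using js by (simp add: compositions_def)
  have "set js \<subseteq> {1..k}"
    using js member_le_sum_list[of _ js] by (auto simp: compositions_def)
  then have D: "D = (\<Prod>l\<in>set js. fact (count_list js l))"
    unfolding D_def by (intro prod.mono_neutral_right) (auto simp: count_list_0_iff)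
  have "D > 0"
    unfolding D_def by (intro prod_pos) simp
  have A: "A = (\<Sum>\<sigma> | \<sigma> permutes {..<length js}. mzs (map ?g (permute_list \<sigma> js)))"
    unfolding A_def mzs_sym_def by (auto intro!: sum.cong simp: permute_list_map)
  have "A > 0"
    unfolding A
  proof (rule sum_pos)
    show "finite {\<sigma>. \<sigma> permutes {..<length js}}"
      by (rule finite_permutations) simp
    show "{\<sigma>. \<sigma> permutes {..<length js}} \<noteq> {}"
      using permutes_id by blast
  qed (use pos in \<open>auto intro!: mzs_pos\<close>)
  have "of_rat (coeff_at (A_hat k) js)
     = (\<Sum>ks\<in>permutations_of_multiset (mset js). (-1) ^ length ks * mzs (map ?g ks) / (2 * pi) ^ (2 * k))"
    by (simp add: coeff_A_hat[OF js] permutations_of_multiset_compositions[OF js])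
  also have "\<dots> = (\<Sum>ks\<in>permutations_of_multiset (mset js). (-1) ^ length js / (2 * pi) ^ (2 * k) * mzs (map ?g ks))"
    by (intro sum.cong) (auto dest!: permutations_of_multisetD mset_eq_length)
  also have "\<dots> = (-1) ^ length js / (2 * pi) ^ (2 * k) * (\<Sum>ks\<in>permutations_of_multiset (mset js). mzs (map ?g ks))"
    by (rule sum_distrib_left[symmetric])
  also have "(\<Sum>ks\<in>permutations_of_multiset (mset js). mzs (map ?g ks)) = A / D"
    using sum_permute_list[of "\<lambda>ks. mzs (map ?g ks)" js] \<open>D > 0\<close> by (simp add: A D)
  finally have eq: "of_rat (coeff_at (A_hat k) js) = (-1) ^ length js / D * (1 / (2 * pi) ^ (2 * k)) * A"
    by simp
  have c: "1 / D * (1 / (2 * pi) ^ (2 * k)) * A > 0"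
    using \<open>A > 0\<close> \<open>D > 0\<close> by simp
  have "odd (length js) \<longrightarrow> (of_rat (coeff_at (A_hat k) js) :: real) < 0"
    and "even (length js) \<longrightarrow> (of_rat (coeff_at (A_hat k) js) :: real) > 0"
    unfolding eq using c by simp_all
  then have "odd (length js) \<longrightarrow> coeff_at (A_hat k) js < 0"
    and "even (length js) \<longrightarrow> coeff_at (A_hat k) js > 0"
    by simp_all
  with eq show ?thesis
    unfolding A_def D_def by blast
qed

end
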